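(* Let $q>0$, $k>0$, let $u_+\ge 0$ and $s>u_+$ satisfy $2qs<(s-u_+)^2$, and set $u_*=2s-u_+$ and $u_-=s+\sqrt{s^2-2qs+u_+^2-2su_+}$. Let $\varphi$ be an ignition function which is either of step type ($\varphi(u)=0$ for $u<u_i$ and $\varphi(u)=1$ for $u>u_i$, where $u_->u_i>u_+$), or, more generally, is any ignition function satisfying $\varphi=0$ in a neighborhood of $u_+$ and $\varphi=1$ in a neighborhood of $[u_-,u_*]$. Let $(\overline u,\overline z)$ be the corresponding strong ZND detonation of Majda's model with speed $s$ and endstates $(u_\pm,z_\pm)$, $z_-=0$, $z_+=1$, and let $D_{ZND}(\lambda)$ be its Lopatinski determinant. Then $D_{ZND}$ has exactly one zero on $\{\lambda\in\mathbb C:\Re\lambda\ge 0\}$; this zero is located at $\lambda=0$ and has multiplicity one.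
   Context: **Model.** The inviscid Majda model is $$(u+qz)_t+\left(\tfrac{u^2}{2}\right)_x=0,\qquad z_t+k\varphi(u)z=0,$$ with $u\ge 0$ a lumped gas-dynamical variable, $z$ the reactant mass fraction, $q$ the heat release, $k>0$ the reaction rate, and $\varphi$ the ignition function. **Strong detonation.** A strong ZND detonation is a weak (distributional) traveling-wave solution $(u,z)(x,t)=(\overline u,\overline z)(\xi)$, $\xi=x-st$, smooth except for a single shock at $\xi=0$, converging to $(u_\pm,z_\pm)$ as $\xi\to\pm\infty$, with $z_-=0$, $z_+=1$, $u_->s>u_+\ge 0$, and (for a step-type ignition function) $u_->u_i>u_+$; write $u_*:=\overline u(0^-)$. Explicitly, the wave is given by $(\overline u,\overline z)(\xi)=(u_+,1)$ for $\xi>0$ and $$\overline z(\xi)=e^{(k/s)\xi},\qquad \overline u(\xi)=s+\sqrt{s^2-2qs\bigl(1-e^{(k/s)\xi}\bigr)+u_+^2-2su_+}\qquad(\xi<0),$$ where $u_*=2s-u_+$, $u_-=s+\sqrt{s^2-2qs+u_+^2-2su_+}$, $s<u_-<u_*$, and $0<q<\frac{(u_*-s)^2}{2s}$, i.e. $2qs<(s-u_+)^2$. **Eigenvalue equation.** On $\xi<0$, with $\overline W=(\overline u,\overline z)^T$, put $$A=\begin{pmatrix}\overline u-s&0\\0&-s\end{pmatrix},\qquad E=\begin{pmatrix}qk\,d\varphi(\overline u)\overline z& qk\varphi(\overline u)\\-k\,d\varphi(\overline u)\overline z&-k\varphi(\overline u)\end{pmatrix},$$ where $d\varphi$ is the derivative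 of $\varphi$. Under the assumptions on $\varphi$, on $\xi<0$ one has $\varphi(\overline u)=1$ and $d\varphi(\overline u)=0$. The eigenvalue equation, linearized about the wave and written in the variable $Z=A\,(u,z)^T$, is $$Z'=G Z,\qquad G=(E-\lambda I)A^{-1},\qquad '=\partial_\xi .$$ **Lopatinski determinant.** For $\Re\lambda\ge 0$, $$D_{ZND}(\lambda):=\det\bigl(Z^-(\lambda,0),\ \lambda[\overline W]-[A\overline W']\bigr),$$ where $[h]:=h(0^+)-h(0^-)$ and $Z^-(\lambda,\xi)$ is a nontrivial solution on $\xi<0$ (with $Z^-(\lambda,0)$ its value at $\xi=0^-$) of $Z'=GZ$ that decays exponentially as $\xi\to-\infty$, chosen to depend analytically on $\lambda$ (on an open neighborhood of $\{\Re\lambda\ge0\}$), and tangent as $\xi\to-\infty$ to the subspace of exponentially decaying solutions of the limiting constant-coefficient system $Z'=G_-Z$, $G_-=\lim_{\xi\to-\infty}G$. $Z^-$ is unique up to multiplication by an analytic factor that does not vanish on $\{\Re\lambda\ge0\}$; this choice does not affect the zeros of $D_{ZND}$ there or their multiplicities. *)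

theory Defs
  imports "HOL-Complex_Analysis.Complex_Analysis"
begin

section \<open>Distributional solutions of the inviscid Majda model\<close>

text \<open>
  \<open>Ck_on n S f\<close> says that \<open>f\<close> is of class C^n on the open set \<open>S\<close>: for \<open>n > 0\<close> it is Frechet
  differentiable on \<open>S\<close> and all its directional derivatives are of class C^(n-1).
\<close>

primrec Ck_on :: "nat \<Rightarrow> 'a::euclidean_space set \<Rightarrow> ('a \<Rightarrow> real) \<Rightarrow> bool" where
  "Ck_on 0 S f \<longleftrightarrow> continuous_on S f"
| "Ck_on (Suc n) S f \<longleftrightarrow>
     (\<exists>f'. (\<forall>x\<in>S. (f has_derivative f' x) (at x)) \<and> (\<forall>v. Ck_on n S (\<lambda>x. f' x v)))"

definition smooth_on :: "'a::euclidean_space set \<Rightarrow> ('a \<Rightarrow> real) \<Rightarrow> bool" where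
  "smooth_on S f \<longleftrightarrow> (\<forall>n. Ck_on n S f)"

definition test_function :: "('a::euclidean_space \<Rightarrow> real) \<Rightarrow> bool" where
  "test_function \<psi> \<longleftrightarrow> smooth_on UNIV \<psi> \<and> compact (closure {p. \<psi> p \<noteq> 0})"

definition locally_integrable :: "('a::euclidean_space \<Rightarrow> real) \<Rightarrow> bool" where
  "locally_integrable f \<longleftrightarrow> (\<forall>K. compact K \<longrightarrow> set_integrable lborel K f)"

text \<open>Points of the plane are \<open>(x, t)\<close>.\<close>

definition partial_x :: "(real \<times> real \<Rightarrow> real) \<Rightarrow> real \<times> real \<Rightarrow> real" where
  "partial_x \<psi> p = frechet_derivative \<psi> (at p) (1, 0)"

definition partial_t :: "(real \<times> real \<Rightarrow> real) \<Rightarrow> real \<times> real \<Rightarrow> real" where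
  "partial_t \<psi> p = frechet_derivative \<psi> (at p) (0, 1)"

text \<open>
  \<open>(u + q z)_t + (u^2/2)_x = 0\<close> and \<open>z_t + k \<phi>(u) z = 0\<close> in the sense of distributions on the
  whole \<open>(x, t)\<close>-plane, tested against \<open>\<psi>\<close> and integrated by parts.
\<close>

definition majda_weak_solution ::
  "real \<Rightarrow> real \<Rightarrow> (real \<Rightarrow> real) \<Rightarrow> (real \<times> real \<Rightarrow> real) \<Rightarrow> (real \<times> real \<Rightarrow> real) \<Rightarrow> bool" where
  "majda_weak_solution q k \<phi> u z \<longleftrightarrow>
     locally_integrable u \<and> locally_integrable z \<and>
     locally_integrable (\<lambda>p. (u p)\<^sup>2) \<and> locally_integrable (\<lambda>p. \<phi> (u p) * z p) \<and>
     (\<forall>\<psi>. test_function \<psi> \<longrightarrow>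
        (\<integral>p. (u p + q * z p) * partial_t \<psi> p + (u p)\<^sup>2 / 2 * partial_x \<psi> p \<partial>lborel) = 0 \<and>
        (\<integral>p. z p * partial_t \<psi> p - k * \<phi> (u p) * z p * \<psi> p \<partial>lborel) = 0)"


section \<open>Strong ZND detonations\<close>

text \<open>
  The endstates are \<open>(um, 0)\<close> at \<open>-\<infinity>\<close> and \<open>(up, 1)\<close> at \<open>+\<infinity>\<close>. The values of the profile at \<open>0\<close>
  itself are immaterial.
\<close>

definition strong_znd_detonation ::
  "real \<Rightarrow> real \<Rightarrow> (real \<Rightarrow> real) \<Rightarrow> real \<Rightarrow> real \<Rightarrow> real \<Rightarrow> (real \<Rightarrow> real) \<Rightarrow> (real \<Rightarrow> real) \<Rightarrow> bool" where
  "strong_znd_detonation q k \<phi> s um up ub zb \<longleftrightarrow>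
     um > s \<and> s > up \<and> up \<ge> 0 \<and>
     majda_weak_solution q k \<phi> (\<lambda>(x, t). ub (x - s * t)) (\<lambda>(x, t). zb (x - s * t)) \<and>
     smooth_on (- {0}) ub \<and> smooth_on (- {0}) zb \<and>
     (\<exists>ul ur. (ub \<longlongrightarrow> ul) (at_left 0) \<and> (ub \<longlongrightarrow> ur) (at_right 0) \<and> ul \<noteq> ur) \<and>
     (\<exists>zl zr. (zb \<longlongrightarrow> zl) (at_left 0) \<and> (zb \<longlongrightarrow> zr) (at_right 0)) \<and>
     (ub \<longlongrightarrow> um) at_bot \<and> (zb \<longlongrightarrow> 0) at_bot \<and>
     (ub \<longlongrightarrow> up) at_top \<and> (zb \<longlongrightarrow> 1) at_top"

definition u_minus :: "real \<Rightarrow> real \<Rightarrow> real \<Rightarrow> real" where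
  "u_minus q s up = s + sqrt (s\<^sup>2 - 2 * q * s + up\<^sup>2 - 2 * s * up)"

definition u_star :: "real \<Rightarrow> real \<Rightarrow> real" where
  "u_star s up = 2 * s - up"

text \<open>Nothing is prescribed at the ignition value \<open>ui\<close> itself.\<close>

definition step_ignition :: "real \<Rightarrow> (real \<Rightarrow> real) \<Rightarrow> bool" where
  "step_ignition ui \<phi> \<longleftrightarrow> (\<forall>u. (u < ui \<longrightarrow> \<phi> u = 0) \<and> (u > ui \<longrightarrow> \<phi> u = 1))"


section \<open>The eigenvalue equation and the Lopatinski determinant\<close>

definition profile :: "(real \<Rightarrow> real) \<Rightarrow> (real \<Rightarrow> real) \<Rightarrow> real \<Rightarrow> complex^2" where
  "profile ub zb \<xi> = vector [of_real (ub \<xi>), of_real (zb \<xi>)]"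

definition A_mat :: "real \<Rightarrow> (real \<Rightarrow> real) \<Rightarrow> real \<Rightarrow> complex^2^2" where
  "A_mat s ub \<xi> = vector [vector [of_real (ub \<xi> - s), 0], vector [0, - of_real s]]"

definition E_mat ::
  "real \<Rightarrow> real \<Rightarrow> (real \<Rightarrow> real) \<Rightarrow> (real \<Rightarrow> real) \<Rightarrow> (real \<Rightarrow> real) \<Rightarrow> real \<Rightarrow> complex^2^2" where
  "E_mat q k \<phi> ub zb \<xi> = vector
     [vector [of_real (q * k * deriv \<phi> (ub \<xi>) * zb \<xi>), of_real (q * k * \<phi> (ub \<xi>))],
      vector [of_real (- k * deriv \<phi> (ub \<xi>) * zb \<xi>), of_real (- k * \<phi> (ub \<xi>))]]"

definition G_mat ::
  "real \<Rightarrow> real \<Rightarrow> (real \<Rightarrow> real) \<Rightarrow> real \<Rightarrow> (real \<Rightarrow> real) \<Rightarrow> (real \<Rightarrow> real) \<Rightarrow> complex \<Rightarrow> real \<Rightarrow> complex^2^2" where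
  "G_mat q k \<phi> s ub zb \<mu> \<xi> = (E_mat q k \<phi> ub zb \<xi> - mat \<mu>) ** matrix_inv (A_mat s ub \<xi>)"

definition G_minus ::
  "real \<Rightarrow> real \<Rightarrow> (real \<Rightarrow> real) \<Rightarrow> real \<Rightarrow> (real \<Rightarrow> real) \<Rightarrow> (real \<Rightarrow> real) \<Rightarrow> complex \<Rightarrow> complex^2^2" where
  "G_minus q k \<phi> s ub zb \<mu> = Lim at_bot (G_mat q k \<phi> s ub zb \<mu>)"

definition decays_exponentially :: "(real \<Rightarrow> 'a::real_normed_vector) \<Rightarrow> bool" where
  "decays_exponentially Y \<longleftrightarrow>
     (\<exists>C \<eta>. \<eta> > 0 \<and> (\<forall>\<^sub>F \<xi> in at_bot. norm (Y \<xi>) \<le> C * exp (\<eta> * \<xi>)))"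

text \<open>
  The subspace of exponentially decaying solutions of \<open>Y' = M Y\<close>, each solution being represented
  by its value at \<open>0\<close>. For constant \<open>M\<close> the values at any other point form the same subspace.
\<close>

definition decaying_subspace :: "complex^2^2 \<Rightarrow> (complex^2) set" where
  "decaying_subspace M =
     {Y 0 |Y. (\<forall>\<xi>. (Y has_vector_derivative M *v Y \<xi>) (at \<xi>)) \<and> decays_exponentially Y}"

text \<open>
  The admissible choices of the family \<open>Z\<^sup>-(\<mu>, \<xi>)\<close>, written \<open>Z \<mu> \<xi>\<close>; \<open>\<mu>\<close> is the
  spectral parameter, since \<open>\<lambda>\<close> is reserved for abstraction. The last argument ranges over
  \<open>\<xi> \<le> 0\<close>, the value at \<open>0\<close> being the limit at \<open>0\<^sup>-\<close>. Tangency to the subspace means that the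
  distance of the normalized solution from it tends to \<open>0\<close>. Recall that \<open>analytic_on\<close> refers to an
  open neighbourhood of the given set.
\<close>

definition decaying_mode ::
  "real \<Rightarrow> real \<Rightarrow> (real \<Rightarrow> real) \<Rightarrow> real \<Rightarrow> (real \<Rightarrow> real) \<Rightarrow> (real \<Rightarrow> real) \<Rightarrow> (complex \<Rightarrow> real \<Rightarrow> complex^2) \<Rightarrow> bool" where
  "decaying_mode q k \<phi> s ub zb Z \<longleftrightarrow>
     (\<forall>\<mu>. Re \<mu> \<ge> 0 \<longrightarrow>
        (\<forall>\<xi><0. (Z \<mu> has_vector_derivative G_mat q k \<phi> s ub zb \<mu> \<xi> *v Z \<mu> \<xi>) (at \<xi>)) \<and>
        (Z \<mu> \<longlongrightarrow> Z \<mu> 0) (at_left 0) \<and>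
        (\<exists>\<xi><0. Z \<mu> \<xi> \<noteq> 0) \<and>
        decays_exponentially (Z \<mu>) \<and>
        ((\<lambda>\<xi>. infdist (Z \<mu> \<xi> /\<^sub>R norm (Z \<mu> \<xi>)) (decaying_subspace (G_minus q k \<phi> s ub zb \<mu>)))
           \<longlongrightarrow> 0) at_bot) \<and>
     (\<forall>\<xi>\<le>0. \<forall>i. (\<lambda>\<mu>. Z \<mu> \<xi> $ i) analytic_on {\<mu>. Re \<mu> \<ge> 0})"

definition jump :: "(real \<Rightarrow> 'a::real_normed_vector) \<Rightarrow> 'a" where
  "jump h = Lim (at_right 0) h - Lim (at_left 0) h"

text \<open>The two vectors are the columns of the determinant, in this order.\<close>

definition D_ZND ::
  "real \<Rightarrow> (real \<Rightarrow> real) \<Rightarrow> (real \<Rightarrow> real) \<Rightarrow> (complex \<Rightarrow> real \<Rightarrow> complex^2) \<Rightarrow> complex \<Rightarrow> complex" where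
  "D_ZND s ub zb Z \<mu> =
     det (transpose (vector
       [Z \<mu> 0,
        \<mu> *s jump (profile ub zb)
          - jump (\<lambda>\<xi>. A_mat s ub \<xi> *v vector_derivative (profile ub zb) (at \<xi>))] :: complex^2^2))"

end

theory Submission
  imports Defs
begin

text \<open>
  Testing the weak equations against \<open>a (x - s t) b t\<close> reduces them to distributional ODEs in \<open>\<xi>\<close>.
  These determine the profile: the state is constant ahead of the shock, \<open>z\<close> is continuous across it,
  and a continuation argument keeps \<open>u\<close> in the region \<open>\<phi> = 1\<close> behind it, so the values of \<open>\<phi>\<close>
  elsewhere play no role.

  With \<open>h = u - s\<close>, \<open>h1 = s - up = h(0\<^sup>-)\<close>, \<open>h0 = h(-\<infinity>)\<close> and \<open>V = Z1 + q Z2\<close>, the determinant is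
  \<open>D = 2 h1 \<mu> Z2 - k V\<close> at \<open>\<xi> = 0\<close>. Since \<open>V' = - \<mu> V / h + \<mu> q Z2 (1 / h + 1 / s)\<close>, Duhamel's formula gives
  \<open>k norm V \<le> norm \<mu> norm Z2 (h1 - h0 + q)\<close> for \<open>Re \<mu> \<ge> 0\<close>, and \<open>h1\<^sup>2 - h0\<^sup>2 = 2 q s\<close> yields
  \<open>h1 - h0 + q < 2 h1\<close>. Hence \<open>norm D\<close> is at least a positive multiple of \<open>norm \<mu> norm Z2\<close>, which excludes
  zeros other than \<open>0\<close> and bounds the derivative at \<open>0\<close> from below.
\<close>

section \<open>Smooth functions and test functions\<close>

text \<open>The combination \<open>V\<close> comes from the conservation law: the row
  \<open>(1, q)\<close> annihilates \<open>E\<close>, because heat is released exactly as reactant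
  is consumed. Hence every term of \<open>V'\<close> carries a factor \<open>\<mu>\<close>, and so
  does the bound on \<open>V\<close>. This lets one inequality treat all frequencies at once:
  \<open>2 h1 \<mu> Z2\<close> and \<open>k V\<close> both shrink linearly at
  \<open>\<mu> = 0\<close>, and the bound keeps their ratio below one uniformly, with no separate
  low- or high-frequency analysis.

  Two obstacles shape the rest. The flux relation determines only the square of
  \<open>u - s\<close>, so its sign has to be carried along by continuity, starting from
  \<open>+\<infinity>\<close> ahead of the shock and from the shock itself behind it. And the zero
  lies on the boundary of the half-plane, where the lower bound for the determinant is available on
  one side only; the derivative there is therefore tested along the positive real axis.\<close>

lemma Ck_on_SucD: "Ck_on (Suc n) S f \<Longrightarrow> Ck_on n S f"
proof (induction n arbitrary: f)
  case 0
  then obtain f' where "\<And>x. x \<in> S \<Longrightarrow> (f has_derivative f' x) (at x)"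
    by auto
  then have "\<forall>x\<in>S. isCont f x"
    using has_derivative_continuous by blast
  then show ?case
    by (simp add: continuous_at_imp_continuous_on)
next
  case (Suc n)
  then show ?case by (metis Ck_on.simps(2))
qed

lemma Ck_on_const: "Ck_on n S (\<lambda>x. c)"
proof (induction n arbitrary: c)
  case (Suc n)
  then show ?case by (auto intro!: exI[of _ "\<lambda>x v. 0"])
qed auto

lemma Ck_on_add: "Ck_on n S f \<Longrightarrow> Ck_on n S g \<Longrightarrow> Ck_on n S (\<lambda>x. f x + g x)"
proof (induction n arbitrary: f g)
  case 0
  then show ?case by (auto intro: continuous_intros)
next
  case (Suc n)
  obtain f' g' where
    "\<And>x. x \<in> S \<Longrightarrow> (f has_derivative f' x) (at x)" "\<And>v. Ck_on n S (\<lambda>x. f' x v)"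
    "\<And>x. x \<in> S \<Longrightarrow> (g has_derivative g' x) (at x)" "\<And>v. Ck_on n S (\<lambda>x. g' x v)"
    using Suc.prems unfolding Ck_on.simps by metis
  with Suc.IH show ?case
    by (auto intro!: exI[of _ "\<lambda>x v. f' x v + g' x v"] derivative_intros)
qed

lemma Ck_on_mult: "Ck_on n S f \<Longrightarrow> Ck_on n S g \<Longrightarrow> Ck_on n S (\<lambda>x. f x * g x)"
proof (induction n arbitrary: f g)
  case 0
  then show ?case by (auto intro: continuous_intros)
next
  case (Suc n)
  obtain f' g' where d:
    "\<And>x. x \<in> S \<Longrightarrow> (f has_derivative f' x) (at x)" "\<And>v. Ck_on n S (\<lambda>x. f' x v)"
    "\<And>x. x \<in> S \<Longrightarrow> (g has_derivative g' x) (at x)" "\<And>v. Ck_on n S (\<lambda>x. g' x v)"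
    using Suc.prems unfolding Ck_on.simps by metis
  \<comment> \<open>The product rule keeps one factor undifferentiated, so that factor has to be
    lowered from class n+1 to class n before the induction hypothesis applies.\<close>
  have "Ck_on n S f" "Ck_on n S g"
    using Suc.prems Ck_on_SucD by blast+
  with d Suc.IH have "Ck_on n S (\<lambda>x. f x * g' x v + f' x v * g x)" for v
    by (intro Ck_on_add) auto
  with d show ?case
    by (auto intro!: exI[of _ "\<lambda>x v. f x * g' x v + f' x v * g x"] derivative_intros)
qed

lemma Ck_on_compose_affine:
  fixes L :: "'a::euclidean_space \<Rightarrow> 'b::euclidean_space"
  assumes "Ck_on n UNIV f" and L: "bounded_linear L"
  shows "Ck_on n UNIV (\<lambda>x. f (L x + c))"
  using assms(1)
proof (induction n arbitrary: f)
  case 0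
  have "continuous_on UNIV (\<lambda>x. L x + c)"
    by (intro continuous_intros linear_continuous_on L)
  with 0 show ?case
    using continuous_on_compose2[of UNIV f UNIV] by auto
next
  case (Suc n)
  then obtain f' where d: "\<And>x. (f has_derivative f' x) (at x)" "\<And>v. Ck_on n UNIV (\<lambda>x. f' x v)"
    by auto
  have "((\<lambda>x. L x + c) has_derivative L) (at x)" for x
    by (auto intro!: derivative_eq_intros bounded_linear.has_derivative[OF L])
  then have "((\<lambda>x. f (L x + c)) has_derivative (\<lambda>v. f' (L x + c) (L v))) (at x)" for x
    using has_derivative_compose[OF _ d(1)] by blast
  with Suc.IH[OF d(2)] show ?case
    by (auto intro!: exI[of _ "\<lambda>x v. f' (L x + c) (L v)"])
qed

text \<open>A linear map on the reals is multiplication by its value at 1, so continuity of the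
  derivative in the single direction 1 is continuity of the ordinary derivative.\<close>

lemma Ck_on_1_real_deriv:
  fixes f :: "real \<Rightarrow> real"
  assumes "Ck_on (Suc 0) S f"
  obtains f' where "\<And>x. x \<in> S \<Longrightarrow> (f has_real_derivative f' x) (at x)" "continuous_on S f'"
proof -
  obtain D where D: "\<And>x. x \<in> S \<Longrightarrow> (f has_derivative D x) (at x)" "continuous_on S (\<lambda>x. D x 1)"
    using assms by auto
  have "D x = (\<lambda>v. D x 1 * v)" if "x \<in> S" for x
  proof
    fix v
    have "bounded_linear (D x)" using D(1)[OF that] by (rule has_derivative_bounded_linear)
    then show "D x v = D x 1 * v"
      using linear_simps(5)[of "D x" v 1] by (simp add: mult.commute)
  qed
  with D show ?thesis
    by (intro that[of "\<lambda>x. D x 1"]) (auto simp: has_field_derivative_def)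
qed

text \<open>The functions \<open>flat p\<close> form a class closed under differentiation, which makes the classical
  \<open>exp (- 1 / x)\<close> smooth.\<close>

definition flat :: "real poly \<Rightarrow> real \<Rightarrow> real" where
  "flat p x = (if x > 0 then poly p (1 / x) * exp (- 1 / x) else 0)"

lemma tendsto_poly_mult_exp_neg: "((\<lambda>x. poly p x * exp (- x)) \<longlongrightarrow> 0) at_top" for p :: "real poly"
proof -
  have "((\<lambda>x. \<Sum>i\<le>degree p. coeff p i * (x ^ i / exp x)) \<longlongrightarrow> (\<Sum>i\<le>degree p. coeff p i * 0)) at_top"
    by (intro tendsto_intros tendsto_power_div_exp_0)
  then show ?thesis
    by (simp add: poly_altdef exp_minus sum_distrib_right sum_divide_distrib field_simps)
qed

lemma flat_tendsto_0: "(flat p \<longlongrightarrow> 0) (at_right 0)"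
proof (rule Lim_transform_eventually)
  show "((\<lambda>x. poly p (inverse x) * exp (- inverse x)) \<longlongrightarrow> 0) (at_right 0)"
    using filterlim_compose[OF tendsto_poly_mult_exp_neg filterlim_inverse_at_top_right] .
  show "\<forall>\<^sub>F x in at_right 0. poly p (inverse x) * exp (- inverse x) = flat p x"
    using eventually_at_right_less by eventually_elim (auto simp: flat_def field_simps)
qed

text \<open>In the variable \<open>y = 1 / x\<close> the derivative falls on \<open>p\<close> or on
  the exponential, which gives \<open>p - pderiv p\<close> up to sign; the chain rule contributes
  \<open>y^2\<close>, written as the polynomial \<open>[:0,0,1:]\<close>. The only delicate point is
  0.\<close>

lemma flat_has_derivative:
  "(flat p has_real_derivative flat ([:0,0,1:] * (p - pderiv p)) x) (at x)"
proof -
  consider "x > 0" | "x < 0" | "x = 0" by linarith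
  then show ?thesis
  proof cases
    case 1
    have i: "((\<lambda>x. - 1 / x) has_real_derivative 1 / x\<^sup>2) (at x)"
      "((\<lambda>x. 1 / x) has_real_derivative - (1 / x\<^sup>2)) (at x)"
      using 1 by (auto intro!: derivative_eq_intros simp: power2_eq_square)
    have "((\<lambda>x. poly p (1 / x) * exp (- 1 / x)) has_real_derivative
        poly (pderiv p) (1 / x) * - (1 / x\<^sup>2) * exp (- 1 / x) +
        exp (- 1 / x) * (1 / x\<^sup>2) * poly p (1 / x)) (at x)"
      by (intro DERIV_mult DERIV_chain2[OF poly_DERIV] DERIV_chain2[OF DERIV_exp] i)
    also have "poly (pderiv p) (1 / x) * - (1 / x\<^sup>2) * exp (- 1 / x) +
        exp (- 1 / x) * (1 / x\<^sup>2) * poly p (1 / x) = flat ([:0,0,1:] * (p - pderiv p)) x"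
      using 1 by (simp add: flat_def field_simps power2_eq_square)
    finally have "((\<lambda>x. poly p (1 / x) * exp (- 1 / x)) has_real_derivative
        flat ([:0,0,1:] * (p - pderiv p)) x) (at x)" .
    moreover have "\<forall>\<^sub>F y in nhds x. y > 0"
      using 1 by (intro eventually_nhds_in_open[of "{0<..}", simplified]) auto
    then have "\<forall>\<^sub>F y in nhds x. flat p y = poly p (1 / y) * exp (- 1 / y)"
      by eventually_elim (auto simp: flat_def)
    ultimately show ?thesis
      by (simp only: DERIV_cong_ev[OF refl _ refl])
  next
    case 2
    then have "\<forall>\<^sub>F y in nhds x. y < 0"
      by (intro eventually_nhds_in_open[of "{..<0}", simplified]) auto
    then have "\<forall>\<^sub>F y in nhds x. flat p y = 0"
      by eventually_elim (auto simp: flat_def)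
    with 2 show ?thesis
      using DERIV_cong_ev[OF refl _ refl, of "flat p" "\<lambda>_. 0" x 0] by (simp add: flat_def)
  next
    case 3
    \<comment> \<open>Dividing by \<open>h\<close> multiplies the polynomial by its variable, so the
      right difference quotient at 0 is again a function of the same class and tends to 0.\<close>
    have "((\<lambda>h. flat (pCons 0 p) h) \<longlongrightarrow> 0) (at_right 0)"
      by (rule flat_tendsto_0)
    moreover have "\<forall>\<^sub>F h in at_right 0. flat (pCons 0 p) h = flat p h / h"
      using eventually_at_right_less by eventually_elim (auto simp: flat_def)
    ultimately have "((\<lambda>h. flat p h / h) \<longlongrightarrow> 0) (at_right 0)"
      by (rule Lim_transform_eventually)
    moreover have "((\<lambda>h. flat p h / h) \<longlongrightarrow> 0) (at_left 0)"
      by (rule tendsto_eventually) (auto simp: eventually_at_filter flat_def)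
    ultimately have "((\<lambda>h. flat p h / h) \<longlongrightarrow> 0) (at 0)"
      by (simp add: filterlim_split_at)
    with 3 show ?thesis
      by (auto simp: DERIV_def flat_def)
  qed
qed

lemma smooth_on_flat: "smooth_on UNIV (flat p)"
proof -
  have "Ck_on n UNIV (flat p)" for n
  proof (induction n arbitrary: p)
    case 0
    then show ?case
      using flat_has_derivative by (auto intro!: continuous_at_imp_continuous_on DERIV_isCont)
  next
    case (Suc n)
    define p' where "p' = [:0,0,1:] * (p - pderiv p)"
    have "Ck_on n UNIV (\<lambda>x. flat p' x * v)" for v
      by (intro Ck_on_mult Ck_on_const Suc.IH)
    moreover have "(flat p has_derivative (\<lambda>v. flat p' x * v)) (at x)" for x
      using flat_has_derivative unfolding p'_def has_field_derivative_def .
    ultimately show ?case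
      by (auto intro!: exI[of _ "\<lambda>x v. flat p' x * v"])
  qed
  then show ?thesis by (simp add: smooth_on_def)
qed

section \<open>Bump functions and compactly supported test functions\<close>

definition bump :: "real \<Rightarrow> real \<Rightarrow> real \<Rightarrow> real" where
  "bump a b x = flat 1 (x - a) * flat 1 (b - x)"

lemma flat_1: "flat 1 x \<ge> 0" "flat 1 x > 0 \<longleftrightarrow> x > 0"
  by (simp_all add: flat_def)

lemma bump_nonneg: "bump a b x \<ge> 0"
  by (simp add: bump_def flat_1)

lemma bump_pos_iff: "bump a b x > 0 \<longleftrightarrow> a < x \<and> x < b"
  using flat_1[of "x - a"] flat_1[of "b - x"]
  by (simp add: bump_def zero_less_mult_iff)

lemma bump_zero: "\<not> (a < x \<and> x < b) \<Longrightarrow> bump a b x = 0"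
  using bump_pos_iff[of a b x] bump_nonneg[of a b x] by linarith

lemma smooth_on_bump: "smooth_on UNIV (bump a b)"
proof -
  have "Ck_on n UNIV (flat 1)" for n
    using smooth_on_flat by (simp add: smooth_on_def)
  then have "Ck_on n UNIV (\<lambda>x. flat 1 (x + - a))" "Ck_on n UNIV (\<lambda>x. flat 1 (- x + b))" for n
    using Ck_on_compose_affine[OF _ bounded_linear_ident, of n "flat 1" "- a"]
      Ck_on_compose_affine[OF _ bounded_linear_minus[OF bounded_linear_ident], of n "flat 1" b]
    by simp_all
  then have "Ck_on n UNIV (\<lambda>x. flat 1 (x + - a) * flat 1 (- x + b))" for n
    by (intro Ck_on_mult)
  moreover have "bump a b = (\<lambda>x. flat 1 (x + - a) * flat 1 (- x + b))"
    by (simp add: bump_def fun_eq_iff)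
  ultimately show ?thesis
    by (simp only: smooth_on_def simp_thms)
qed

lemma compact_closure_support:
  fixes f :: "'a::euclidean_space \<Rightarrow> real"
  assumes "compact K" "\<And>x. x \<notin> K \<Longrightarrow> f x = 0"
  shows "compact (closure {x. f x \<noteq> 0})"
proof -
  have "{x. f x \<noteq> 0} \<subseteq> K" using assms(2) by blast
  then show ?thesis
    using bounded_subset[OF compact_imp_bounded[OF assms(1)]] by (simp add: compact_closure)
qed

lemma test_function_bump: "test_function (bump a b)"
proof -
  have "compact (closure {x. bump a b x \<noteq> 0})"
    by (rule compact_closure_support[OF compact_Icc[of a b]]) (auto intro: bump_zero)
  then show ?thesis
    by (simp add: test_function_def smooth_on_bump)
qed

lemma test_function_real:
  fixes a :: "real \<Rightarrow> real"
  assumes "test_function a"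
  shows "(a has_real_derivative deriv a x) (at x)" "continuous_on UNIV (deriv a)" "continuous_on UNIV a"
    "\<exists>M::real. \<forall>x. \<bar>x\<bar> > M \<longrightarrow> a x = 0 \<and> deriv a x = 0"
proof -
  obtain a' where a': "\<And>x. (a has_real_derivative a' x) (at x)" "continuous_on UNIV a'"
    using Ck_on_1_real_deriv[of UNIV a] assms
    unfolding test_function_def smooth_on_def by (metis UNIV_I)
  then have "deriv a = a'" by (auto intro: DERIV_imp_deriv)
  with a' show "(a has_real_derivative deriv a x) (at x)" "continuous_on UNIV (deriv a)" 
    by auto
  show "continuous_on UNIV a"
    using a' by (auto intro!: continuous_at_imp_continuous_on DERIV_isCont)
  obtain M where M: "\<And>x. x \<in> closure {p. a p \<noteq> 0} \<Longrightarrow> norm x \<le> M"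
    using assms unfolding test_function_def by (meson bounded_iff compact_imp_bounded)
  have 0: "a x = 0" if "\<bar>x\<bar> > M" for x
    using M[of x] that closure_subset[of "{p. a p \<noteq> 0}"] by force
  have "deriv a x = 0" if "\<bar>x\<bar> > M" for x
  proof -
    have "\<forall>\<^sub>F y in nhds x. y \<in> {y. \<bar>y\<bar> > M}"
      using that by (intro eventually_nhds_in_open open_Collect_less continuous_intros) auto
    then have "\<forall>\<^sub>F y in nhds x. a y = 0"
      by eventually_elim (use 0 in auto)
    then have "deriv a x = deriv (\<lambda>_. 0) x" by (rule deriv_cong_ev) simp
    then show ?thesis by simp
  qed
  with 0 show "\<exists>M. \<forall>x. \<bar>x\<bar> > M \<longrightarrow> a x = 0 \<and> deriv a x = 0" by blast
qed

lemma test_function_scale: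
  fixes a :: "real \<Rightarrow> real"
  assumes "test_function a" "m > 0"
  shows "test_function (\<lambda>x. a (m * x))"
proof -
  have "Ck_on n UNIV a" for n
    using assms by (simp only: smooth_on_def test_function_def)
  then have "Ck_on n UNIV (\<lambda>x. a (m * x))" for n
    using Ck_on_compose_affine[OF _ bounded_linear_mult_right, of n a m 0] by simp
  moreover obtain M where M: "\<And>x. \<bar>x\<bar> > M \<Longrightarrow> a x = 0"
    using test_function_real(4)[OF assms(1)] by blast
  have "compact (closure {x. a (m * x) \<noteq> 0})"
  proof (rule compact_closure_support[OF compact_Icc[of "- (M / m)" "M / m"]])
    fix x assume "x \<notin> {- (M / m)..M / m}"
    then have "\<bar>x\<bar> > M / m" by auto
    then have "\<bar>m * x\<bar> > M"
      using assms(2) by (simp add: abs_mult field_simps)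
    then show "a (m * x) = 0" by (rule M)
  qed
  ultimately show ?thesis by (simp add: test_function_def smooth_on_def)
qed

lemma test_function_wave:
  fixes a b :: "real \<Rightarrow> real"
  assumes "test_function a" "test_function b"
  shows "test_function (\<lambda>(x, t). a (x - s * t) * b t)"
proof -
  have L: "bounded_linear (\<lambda>p::real \<times> real. fst p - s * snd p)"
    by (intro bounded_linear_sub bounded_linear_const_mult bounded_linear_fst bounded_linear_snd)
  have "Ck_on n UNIV a" "Ck_on n UNIV b" for n
    using assms by (simp_all only: smooth_on_def test_function_def)
  then have 1: "Ck_on n UNIV (\<lambda>p. a (fst p - s * snd p) * b (snd p))" for n
    using Ck_on_compose_affine[OF _ L, of n a 0] Ck_on_compose_affine[OF _ bounded_linear_snd, of n b 0]
    by (intro Ck_on_mult) simp_all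
  obtain M N where M: "\<And>x. \<bar>x\<bar> > M \<Longrightarrow> a x = 0" and N: "\<And>x. \<bar>x\<bar> > N \<Longrightarrow> b x = 0"
    using test_function_real(4)[OF assms(1)] test_function_real(4)[OF assms(2)] by blast
  have "compact (closure {p. (\<lambda>(x, t). a (x - s * t) * b t) p \<noteq> 0})"
  proof (rule compact_closure_support)
    \<comment> \<open>The support is a sheared rectangle; where
      \<open>\<bar>t\<bar> \<le> N\<close>, the shift \<open>s * t\<close> is at most
      \<open>\<bar>s\<bar> * N\<close>, so this upright rectangle contains it.\<close>
    show "compact ({- (M + \<bar>s\<bar> * N)..M + \<bar>s\<bar> * N} \<times> {- N..N})"
      by (intro compact_Times compact_Icc)
    show "(\<lambda>(x, t). a (x - s * t) * b t) p = 0"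
      if "p \<notin> {- (M + \<bar>s\<bar> * N)..M + \<bar>s\<bar> * N} \<times> {- N..N}" for p
    proof (cases p)
      case (Pair x t)
      have "\<bar>x\<bar> \<le> M + \<bar>s\<bar> * N" if "\<bar>t\<bar> \<le> N" "\<bar>x - s * t\<bar> \<le> M"
      proof -
        have "\<bar>s * t\<bar> \<le> \<bar>s\<bar> * N" using that by (simp add: abs_mult mult_left_mono)
        with that show ?thesis by linarith
      qed
      then have "\<bar>t\<bar> > N \<or> \<bar>x - s * t\<bar> > M"
        using that Pair by force
      then show ?thesis using M N Pair by auto
    qed
  qed
  with 1 show ?thesis
    by (simp add: test_function_def smooth_on_def case_prod_unfold)
qed

section \<open>Weak travelling waves as distributional equations on the line\<close>

text \<open>Intervals have positive length. This turns almost-everywhere statements into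
  contradictions: a function positive on an interval cannot vanish almost everywhere, and an almost
  sure property holds at some time in \<open>(0, 1)\<close>.\<close>

lemma not_AE_notin_Ioo:
  fixes a b :: real
  assumes "a < b" "AE x in lborel. x \<notin> {a<..<b}"
  shows False
proof -
  have "{a<..<b} \<in> null_sets lborel"
    using assms(2) by (simp add: AE_iff_null_sets)
  then show False using assms(1) by (simp add: null_sets_def)
qed

lemma locally_integrable_continuous:
  fixes f :: "'a::euclidean_space \<Rightarrow> real"
  shows "continuous_on UNIV f \<Longrightarrow> locally_integrable f"
  unfolding locally_integrable_def set_integrable_def
  by (intro allI impI borel_integrable_compact) (auto intro: continuous_on_subset)

text \<open>Continuity on the compact set \<open>K\<close> bounds \<open>g\<close>, so the product
  is dominated by a constant multiple of \<open>f\<close> restricted to \<open>K\<close>.\<close>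

lemma locally_integrable_mult:
  fixes f g :: "'a::euclidean_space \<Rightarrow> real"
  assumes f: "locally_integrable f" and g: "continuous_on UNIV g" and K: "compact K" "\<And>x. x \<notin> K \<Longrightarrow> g x = 0"
  shows "integrable lborel (\<lambda>x. f x * g x)"
proof -
  have [measurable]: "g \<in> borel_measurable lborel"
    using borel_measurable_continuous_onI[OF g] by simp
  have fK: "integrable lborel (\<lambda>x. indicator K x * f x)"
    using f K by (simp add: locally_integrable_def set_integrable_def)
  have "compact (g ` K)" using K g compact_continuous_image continuous_on_subset by blast
  then obtain C where C: "\<And>x. x \<in> K \<Longrightarrow> \<bar>g x\<bar> \<le> C"
    by (force dest: compact_imp_bounded simp: bounded_iff)
  have C': "\<bar>g x\<bar> \<le> \<bar>C\<bar>" for x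
    using C[of x] K(2)[of x] by (cases "x \<in> K") auto
  have "integrable lborel (\<lambda>x. (indicator K x * f x) * g x)"
  proof (rule Bochner_Integration.integrable_bound)
    show "integrable lborel (\<lambda>x. \<bar>C\<bar> * (indicator K x * f x))"
      using fK by (rule integrable_mult_right)
    show "(\<lambda>x. (indicator K x * f x) * g x) \<in> borel_measurable lborel"
      using fK by measurable
    show "AE x in lborel. norm (indicator K x * f x * g x) \<le> norm (\<bar>C\<bar> * (indicator K x * f x))"
      using C' by (intro always_eventually) (auto simp: abs_mult mult.commute intro!: mult_right_mono)
  qed
  moreover have "(indicator K x * f x) * g x = f x * g x" for x
    using K(2)[of x] by (cases "x \<in> K") auto
  ultimately show ?thesis by simp
qed

text \<open>By Fubini almost every time slice of the planar function is integrable over a rectangle;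
  one good slice, translated back by \<open>s * t\<close>, is \<open>f\<close> itself.\<close>

lemma locally_integrable_wave:
  fixes f :: "real \<Rightarrow> real"
  assumes f: "locally_integrable (\<lambda>(x, t). f (x - s * t))"
  shows "locally_integrable f"
  unfolding locally_integrable_def
proof (intro allI impI)
  fix K :: "real set" assume K: "compact K"
  then obtain M where M: "\<And>x. x \<in> K \<Longrightarrow> \<bar>x\<bar> \<le> M"
    by (force dest: compact_imp_bounded simp: bounded_iff)
  \<comment> \<open>Wide enough to contain \<open>K + s * t\<close> for every \<open>t\<close> in
    \<open>[0, 1]\<close>, so that whichever slice turns out to be good covers all of
    \<open>K\<close>.\<close>
  define R where "R = {-(M + \<bar>s\<bar>)..M + \<bar>s\<bar>} \<times> {0..1::real}"
  have "compact R" unfolding R_def by (intro compact_Times compact_Icc)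
  then have "integrable lborel (\<lambda>p. indicator R p * (case p of (x, t) \<Rightarrow> f (x - s * t)))"
    using f by (simp add: locally_integrable_def set_integrable_def)
  then have "integrable (lborel \<Otimes>\<^sub>M lborel) (\<lambda>(x, t). indicator R (x, t) * f (x - s * t))"
    by (simp add: lborel_prod case_prod_unfold)
  then have "AE t in lborel. integrable lborel (\<lambda>x. indicator R (x, t) * f (x - s * t))"
    by (rule lborel_pair.AE_integrable_snd)
  then have "\<exists>t\<in>{0..1}. integrable lborel (\<lambda>x. indicator R (x, t) * f (x - s * t))"
  proof (rule contrapos_pp)
    assume c: "\<not> ?thesis"
    show "\<not> (AE t in lborel. integrable lborel (\<lambda>x. indicator R (x, t) * f (x - s * t)))"
    proof
      assume "AE t in lborel. integrable lborel (\<lambda>x. indicator R (x, t) * f (x - s * t))"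
      then have "AE t in lborel. t \<notin> {0<..<1::real}"
        by eventually_elim (use c in force)
      then show False using not_AE_notin_Ioo[of 0 1] by simp
    qed
  qed
  then obtain t where t: "0 \<le> t" "t \<le> 1" and "integrable lborel (\<lambda>x. indicator R (x, t) * f (x - s * t))"
    by auto
  from lborel_integrable_real_affine[OF this(3), of 1 "s * t"]
  have i: "integrable lborel (\<lambda>x. indicator R (s * t + x, t) * f x)" by simp
  have "integrable lborel (\<lambda>x. indicator K x * (indicator R (s * t + x, t) * f x))"
    using integrable_mult_indicator[OF _ i, of K] K by (simp add: compact_imp_closed)
  moreover have "indicator K x * (indicator R (s * t + x, t) * f x) = indicator K x * f x" for x
  proof (cases "x \<in> K")
    case True
    have "\<bar>s * t\<bar> \<le> \<bar>s\<bar>" using t by (simp add: abs_mult mult_left_le)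
    with M[OF True] t have "(s * t + x, t) \<in> R"
      by (auto simp: R_def)
    then show ?thesis by simp
  qed auto
  ultimately show "set_integrable lborel K f"
    by (simp add: set_integrable_def)
qed

text \<open>With the time integral outside, translation invariance in \<open>x\<close> replaces
  \<open>x - s * t\<close> by \<open>x\<close> in the inner integral, which then no longer depends
  on \<open>t\<close>.\<close>

lemma wave_integral:
  fixes f c d :: "real \<Rightarrow> real"
  assumes f: "locally_integrable (\<lambda>(x, t). f (x - s * t))"
    and c: "continuous_on UNIV c" "\<And>x. \<bar>x\<bar> > M \<Longrightarrow> c x = 0"
    and d: "continuous_on UNIV d" "\<And>x. \<bar>x\<bar> > N \<Longrightarrow> d x = 0"
  shows "integrable lborel (\<lambda>(x, t). f (x - s * t) * (c (x - s * t) * d t))" (is ?i)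
    and "(\<integral>(x, t). f (x - s * t) * (c (x - s * t) * d t) \<partial>lborel) =
      (\<integral>x. f x * c x \<partial>lborel) * (\<integral>t. d t \<partial>lborel)"
proof -
  define K where "K = {- (M + \<bar>s\<bar> * N)..M + \<bar>s\<bar> * N} \<times> {- N..N}"
  have K: "compact K" unfolding K_def by (intro compact_Times compact_Icc)
  have z: "c (fst p - s * snd p) * d (snd p) = 0" if "p \<notin> K" for p
  proof (cases p)
    case (Pair x t)
    have "\<bar>x\<bar> \<le> M + \<bar>s\<bar> * N" if "\<bar>t\<bar> \<le> N" "\<bar>x - s * t\<bar> \<le> M"
    proof -
      have "\<bar>s * t\<bar> \<le> \<bar>s\<bar> * N" using that by (simp add: abs_mult mult_left_mono)
      with that show ?thesis by linarith
    qed
    then have "\<bar>t\<bar> > N \<or> \<bar>x - s * t\<bar> > M"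
      using that Pair by (force simp: K_def)
    then show ?thesis using c d Pair by auto
  qed
  have "continuous_on UNIV (\<lambda>p. c (fst p - s * snd p) * d (snd p))"
    by (intro continuous_on_mult continuous_on_compose2[OF c(1)] continuous_on_compose2[OF d(1)] continuous_intros) auto
  from locally_integrable_mult[OF f this K z]
  show i: ?i by (simp add: case_prod_unfold)
  have "(\<integral>(x, t). f (x - s * t) * (c (x - s * t) * d t) \<partial>lborel) =
     (\<integral>t. (\<integral>x. f (x - s * t) * (c (x - s * t) * d t) \<partial>lborel) \<partial>lborel)"
    using i by (subst lborel_pair.integral_snd) (simp_all add: lborel_prod)
  also have "\<dots> = (\<integral>t. (\<integral>x. f x * c x \<partial>lborel) * d t \<partial>lborel)"
  proof (rule Bochner_Integration.integral_cong[OF refl])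
    fix t
    show "(\<integral>x. f (x - s * t) * (c (x - s * t) * d t) \<partial>lborel) = (\<integral>x. f x * c x \<partial>lborel) * d t"
      using lborel_integral_real_affine[of 1 "\<lambda>x. f (x - s * t) * (c (x - s * t) * d t)" "s * t"]
      by (simp add: mult.assoc[symmetric])
  qed
  finally show "(\<integral>(x, t). f (x - s * t) * (c (x - s * t) * d t) \<partial>lborel) =
      (\<integral>x. f x * c x \<partial>lborel) * (\<integral>t. d t \<partial>lborel)"
    by simp
qed

lemma integral_deriv_test_function:
  fixes b :: "real \<Rightarrow> real"
  assumes "test_function b"
  shows "(\<integral>t. deriv b t \<partial>lborel) = 0"
proof -
  obtain M where M: "\<And>x. \<bar>x\<bar> > M \<Longrightarrow> b x = 0" "\<And>x. \<bar>x\<bar> > M \<Longrightarrow> deriv b x = 0"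
    using test_function_real(4)[OF assms] by blast
  \<comment> \<open>Strictly beyond \<open>\<bar>M\<bar>\<close>, so that both boundary terms
    \<open>b m\<close> and \<open>b (- m)\<close> vanish.\<close>
  define m where "m = \<bar>M\<bar> + 1"
  have "(\<integral>t. deriv b t * indicator {- m..m} t \<partial>lborel) = b m - b (- m)"
    using test_function_real[OF assms]
    by (intro integral_FTC_Icc_real) (auto simp: m_def continuous_on_eq_continuous_at)
  moreover have "(\<lambda>t. deriv b t * indicator {- m..m} t) = deriv b"
  proof
    fix t show "deriv b t * indicator {- m..m} t = deriv b t"
      using M(2)[of t] by (cases "\<bar>t\<bar> > M") (auto simp: m_def indicator_def)
  qed
  ultimately show ?thesis
    using M(1)[of m] M(1)[of "- m"] by (simp add: m_def)
qed

lemma wave_test_function_derivatives: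
  fixes a b :: "real \<Rightarrow> real"
  assumes a: "test_function a" and b: "test_function b"
  shows "partial_x (\<lambda>(x, t). a (x - s * t) * b t) (x, t) = deriv a (x - s * t) * b t"
    and "partial_t (\<lambda>(x, t). a (x - s * t) * b t) (x, t) =
      - s * (deriv a (x - s * t) * b t) + a (x - s * t) * deriv b t"
proof -
  have da: "(a has_derivative (\<lambda>v. deriv a y * v)) (at y)" for y
    using test_function_real(1)[OF a] by (simp add: has_field_derivative_def)
  have db: "(b has_derivative (\<lambda>v. deriv b y * v)) (at y)" for y
    using test_function_real(1)[OF b] by (simp add: has_field_derivative_def)
  have l: "((\<lambda>p. fst p - s * snd p) has_derivative (\<lambda>v. fst v - s * snd v)) (at p)" for p :: "real \<times> real"
    by (auto intro!: derivative_eq_intros)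
  have "((\<lambda>p. a (fst p - s * snd p) * b (snd p)) has_derivative
     (\<lambda>v. a (x - s * t) * (deriv b t * snd v) + deriv a (x - s * t) * (fst v - s * snd v) * b t)) (at (x, t))"
    using has_derivative_mult[OF has_derivative_compose[OF l da]
        has_derivative_compose[OF has_derivative_snd[OF has_derivative_ident] db], of "(x, t)"]
    by simp
  from frechet_derivative_at[OF this, symmetric]
  show "partial_x (\<lambda>(x, t). a (x - s * t) * b t) (x, t) = deriv a (x - s * t) * b t"
    and "partial_t (\<lambda>(x, t). a (x - s * t) * b t) (x, t) =
      - s * (deriv a (x - s * t) * b t) + a (x - s * t) * deriv b t"
    by (simp_all add: partial_x_def partial_t_def case_prod_unfold algebra_simps)
qed

text \<open>Testing against \<open>a (x - s * t) * b t\<close> separates the variables by Fubini; the terms with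
  \<open>deriv b\<close> integrate to \<open>0\<close>.\<close>

lemma majda_weak_solution_travelling_wave:
  fixes ub zb \<phi> a :: "real \<Rightarrow> real"
  assumes w: "majda_weak_solution q k \<phi> (\<lambda>(x, t). ub (x - s * t)) (\<lambda>(x, t). zb (x - s * t))"
    and a: "test_function a"
  shows "(\<integral>x. ((ub x)\<^sup>2 / 2 - s * (ub x + q * zb x)) * deriv a x \<partial>lborel) = 0"
    and "(\<integral>x. s * zb x * deriv a x + k * \<phi> (ub x) * zb x * a x \<partial>lborel) = 0"
    and "locally_integrable ub" "locally_integrable zb" "locally_integrable (\<lambda>x. (ub x)\<^sup>2)"
      "locally_integrable (\<lambda>x. \<phi> (ub x) * zb x)"
proof -
  \<comment> \<open>The time profile enters only through its integral, which multiplies the whole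
    spatial identity; it has to be nonzero so that it can be divided out.\<close>
  define b where "b = bump 0 1"
  have b: "test_function b" unfolding b_def by (rule test_function_bump)
  have b0: "(\<integral>t. deriv b t \<partial>lborel) = 0" using integral_deriv_test_function[OF b] .
  have ib: "integrable lborel b"
    using locally_integrable_mult[OF locally_integrable_continuous[of "\<lambda>_. 1"]
        test_function_real(3)[OF b] compact_Icc[of 0 1]]
    by (force simp: b_def bump_zero)
  have b1: "(\<integral>t. b t \<partial>lborel) > 0"
  proof -
    have "(\<integral>t. b t \<partial>lborel) \<noteq> 0"
    proof
      assume "(\<integral>t. b t \<partial>lborel) = 0"
      then have "AE t in lborel. b t = 0"
        using integral_nonneg_eq_0_iff_AE[OF ib] bump_nonneg by (simp add: b_def)
      then have "AE t in lborel. t \<notin> {0<..<1::real}"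
        by eventually_elim (auto simp: b_def dest: bump_pos_iff[THEN iffD2, OF conjI])
      then show False using not_AE_notin_Ioo[of 0 1] by simp
    qed
    moreover have "(\<integral>t. b t \<partial>lborel) \<ge> 0" by (simp add: b_def bump_nonneg)
    ultimately show ?thesis by simp
  qed
  have li: "locally_integrable (\<lambda>(x, t). ub (x - s * t))" "locally_integrable (\<lambda>(x, t). zb (x - s * t))"
     "locally_integrable (\<lambda>(x, t). (ub (x - s * t))\<^sup>2)"
     "locally_integrable (\<lambda>(x, t). \<phi> (ub (x - s * t)) * zb (x - s * t))"
    using w by (simp_all add: majda_weak_solution_def case_prod_unfold)
  then show li1: "locally_integrable ub" "locally_integrable zb" "locally_integrable (\<lambda>x. (ub x)\<^sup>2)"
      "locally_integrable (\<lambda>x. \<phi> (ub x) * zb x)"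
    using locally_integrable_wave[of _ s] by (auto simp: case_prod_unfold)
  obtain M where M: "\<And>x. \<bar>x\<bar> > M \<Longrightarrow> a x = 0" "\<And>x. \<bar>x\<bar> > M \<Longrightarrow> deriv a x = 0"
    using test_function_real(4)[OF a] by blast
  obtain N where N: "\<And>x. \<bar>x\<bar> > N \<Longrightarrow> b x = 0" "\<And>x. \<bar>x\<bar> > N \<Longrightarrow> deriv b x = 0"
    using test_function_real(4)[OF b] by blast
  note ca = test_function_real(2,3)[OF a] and cb = test_function_real(2,3)[OF b]
  note W1 = wave_integral[OF _ ca(1) M(2) cb(2) N(1)]
    and W2 = wave_integral[OF _ ca(2) M(1) cb(1) N(2)]
    and W3 = wave_integral[OF _ ca(2) M(1) cb(2) N(1)]
  have ia: "integrable lborel (\<lambda>x. f x * deriv a x)" "integrable lborel (\<lambda>x. f x * a x)"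
    if "locally_integrable f" for f
    using locally_integrable_mult[OF that ca(1) compact_Icc[of "-M" M]]
       locally_integrable_mult[OF that ca(2) compact_Icc[of "-M" M]] M by (force)+
  let ?\<psi> = "\<lambda>(x, t). a (x - s * t) * b t"
  have "test_function ?\<psi>" by (rule test_function_wave[OF a b])
  then have e: "(\<integral>(x, t). (ub (x - s * t) + q * zb (x - s * t)) * partial_t ?\<psi> (x, t)
        + (ub (x - s * t))\<^sup>2 / 2 * partial_x ?\<psi> (x, t) \<partial>lborel) = 0"
     "(\<integral>(x, t). zb (x - s * t) * partial_t ?\<psi> (x, t)
        - k * \<phi> (ub (x - s * t)) * zb (x - s * t) * ?\<psi> (x, t) \<partial>lborel) = 0"
    using w unfolding majda_weak_solution_def by (simp_all add: case_prod_unfold)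
  let ?I = "\<lambda>f c d. \<lambda>p :: real \<times> real. f (fst p - s * snd p) * (c (fst p - s * snd p) * d (snd p) :: real) :: real"
  \<comment> \<open>The integrand is split into pure products, one per density and derivative, since
    the separation of variables is available only for a single product.\<close>
  have "(\<lambda>(x, t). (ub (x - s * t) + q * zb (x - s * t)) * partial_t ?\<psi> (x, t)
        + (ub (x - s * t))\<^sup>2 / 2 * partial_x ?\<psi> (x, t)) =
      (\<lambda>p. - s * ?I ub (deriv a) b p + ?I ub a (deriv b) p
        + (- s * q) * ?I zb (deriv a) b p + q * ?I zb a (deriv b) p
        + 1 / 2 * ?I (\<lambda>x. (ub x)\<^sup>2) (deriv a) b p)"
    unfolding wave_test_function_derivatives[OF a b] by (auto simp: fun_eq_iff algebra_simps)
  with e(1) li have "(- s * (\<integral>x. ub x * deriv a x \<partial>lborel) + (- s * q) * (\<integral>x. zb x * deriv a x \<partial>lborel)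
      + 1 / 2 * (\<integral>x. (ub x)\<^sup>2 * deriv a x \<partial>lborel)) * (\<integral>t. b t \<partial>lborel) = 0"
    using W1[of ub] W1[of zb] W1[of "\<lambda>x. (ub x)\<^sup>2"] W2[of ub] W2[of zb] b0
    by (simp add: case_prod_unfold algebra_simps)
  then have "- s * (\<integral>x. ub x * deriv a x \<partial>lborel) + (- s * q) * (\<integral>x. zb x * deriv a x \<partial>lborel)
      + 1 / 2 * (\<integral>x. (ub x)\<^sup>2 * deriv a x \<partial>lborel) = 0"
    using b1 by simp
  moreover have "(\<lambda>x. ((ub x)\<^sup>2 / 2 - s * (ub x + q * zb x)) * deriv a x) =
     (\<lambda>x. - s * (ub x * deriv a x) + (- s * q) * (zb x * deriv a x) + 1 / 2 * ((ub x)\<^sup>2 * deriv a x))"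
    by (auto simp: fun_eq_iff algebra_simps)
  ultimately show "(\<integral>x. ((ub x)\<^sup>2 / 2 - s * (ub x + q * zb x)) * deriv a x \<partial>lborel) = 0"
    using ia li1 by simp
  have "(\<lambda>(x, t). zb (x - s * t) * partial_t ?\<psi> (x, t)
        - k * \<phi> (ub (x - s * t)) * zb (x - s * t) * ?\<psi> (x, t)) =
      (\<lambda>p. - s * ?I zb (deriv a) b p + ?I zb a (deriv b) p
        + (- k) * ?I (\<lambda>x. \<phi> (ub x) * zb x) a b p)"
    unfolding wave_test_function_derivatives[OF a b] by (auto simp: fun_eq_iff algebra_simps)
  with e(2) li have "(- s * (\<integral>x. zb x * deriv a x \<partial>lborel)
      + (- k) * (\<integral>x. \<phi> (ub x) * zb x * a x \<partial>lborel)) * (\<integral>t. b t \<partial>lborel) = 0"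
    using W1[of zb] W2[of zb] W3[of "\<lambda>x. \<phi> (ub x) * zb x"] b0
    by (simp add: case_prod_unfold algebra_simps)
  then have "- s * (\<integral>x. zb x * deriv a x \<partial>lborel) + (- k) * (\<integral>x. \<phi> (ub x) * zb x * a x \<partial>lborel) = 0"
    using b1 by simp
  moreover have "(\<lambda>x. s * zb x * deriv a x + k * \<phi> (ub x) * zb x * a x) =
     (\<lambda>x. s * (zb x * deriv a x) + k * (\<phi> (ub x) * zb x * a x))"
    by (auto simp: fun_eq_iff algebra_simps)
  ultimately show "(\<integral>x. s * zb x * deriv a x + k * \<phi> (ub x) * zb x * a x \<partial>lborel) = 0"
    using ia li1 by simp
qed

section \<open>Distributional derivatives on the line\<close>

text \<open>The derivative of \<open>F\<close> as a distribution is \<open>g\<close>. Local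
  integrability is part of the notion because the integral of a non-integrable function is 0 by
  convention, which could satisfy the identity spuriously.\<close>

definition weak_deriv :: "(real \<Rightarrow> real) \<Rightarrow> (real \<Rightarrow> real) \<Rightarrow> bool" where
  "weak_deriv F g \<longleftrightarrow> locally_integrable F \<and> locally_integrable g \<and>
     (\<forall>a. test_function a \<longrightarrow> (\<integral>x. F x * deriv a x + g x * a x \<partial>lborel) = 0)"

lemma deriv_bump_zero:
  assumes "x \<notin> {a..b}"
  shows "deriv (bump a b) x = 0"
proof -
  have "\<forall>\<^sub>F y in nhds x. y \<in> - {a..b}"
    using assms by (intro eventually_nhds_in_open) auto
  then have "\<forall>\<^sub>F y in nhds x. bump a b y = 0"
    by eventually_elim (auto intro: bump_zero)
  then have "deriv (bump a b) x = deriv (\<lambda>_. 0) x" by (rule deriv_cong_ev) simp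
  then show ?thesis by simp
qed

text \<open>This is the fundamental lemma of the calculus of variations: if \<open>F'\<close> and
  \<open>G\<close> differed at \<open>x0\<close>, their difference would keep one sign nearby, and a
  bump supported there would detect it. Comparing \<open>g\<close> with a continuous
  \<open>G\<close> on \<open>S\<close> only allows \<open>g\<close> to be irregular elsewhere, as
  the reaction term may be.\<close>

lemma weak_deriv_eq_deriv:
  assumes w: "weak_deriv F g" and "open S" "x0 \<in> S"
    and F: "\<And>x. x \<in> S \<Longrightarrow> (F has_real_derivative F' x) (at x)" "continuous_on S F'"
    and G: "continuous_on S G" "\<And>x. x \<in> S \<Longrightarrow> g x = G x"
  shows "F' x0 = G x0"
proof (rule ccontr)
  define H where "H = (\<lambda>x. F' x - G x)"
  assume "F' x0 \<noteq> G x0"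
  then have "H x0 \<noteq> 0" by (simp add: H_def)
  define \<sigma> where "\<sigma> = sgn (H x0)"
  have \<sigma>: "\<sigma> * H x0 > 0" using \<open>H x0 \<noteq> 0\<close> by (simp add: \<sigma>_def sgn_if)
  have cH: "continuous_on S (\<lambda>x. \<sigma> * H x)" unfolding H_def by (intro continuous_intros F G)
  have "open ((\<lambda>x. \<sigma> * H x) -` {0<..} \<inter> S)"
    using continuous_openin_preimage_gen[OF cH, of "{0<..}"] \<open>open S\<close>
    by (auto simp: openin_open_eq Int_commute)
  moreover have "x0 \<in> (\<lambda>x. \<sigma> * H x) -` {0<..} \<inter> S" using \<sigma> \<open>x0 \<in> S\<close> by auto
  ultimately obtain e where e: "e > 0" "cball x0 e \<subseteq> (\<lambda>x. \<sigma> * H x) -` {0<..} \<inter> S"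
    using open_contains_cball by blast
  define \<alpha> \<beta> where "\<alpha> = x0 - e" and "\<beta> = x0 + e"
  have ab: "\<alpha> < \<beta>" "{\<alpha>..\<beta>} \<subseteq> S" "\<And>x. x \<in> {\<alpha>..\<beta>} \<Longrightarrow> \<sigma> * H x > 0"
    using e by (auto simp: \<alpha>_def \<beta>_def cball_eq_atLeastAtMost)
  define a where "a = bump \<alpha> \<beta>"
  have a: "test_function a" unfolding a_def by (rule test_function_bump)
  have a0: "a x = 0" "deriv a x = 0" if "x \<notin> {\<alpha>..\<beta>}" for x
    using that deriv_bump_zero by (auto simp: a_def intro: bump_zero)
  note da = test_function_real(1)[OF a] and ca = test_function_real(2,3)[OF a]
  have cont: "isCont F x" "isCont F' x" "isCont G x" "isCont a x" "isCont (deriv a) x" if "x \<in> {\<alpha>..\<beta>}" for x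
    using F G that ab(2) \<open>open S\<close> ca DERIV_isCont[OF F(1)]
    by (auto simp: continuous_on_eq_continuous_at)
  \<comment> \<open>Integrating the derivative of \<open>F * a\<close> gives the same identity with
    the classical derivative in place of \<open>g\<close>; subtracting the weak one leaves the
    integral of \<open>H * a\<close>.\<close>
  have FTC: "has_bochner_integral lborel (\<lambda>x. (F x * deriv a x + F' x * a x) * indicator {\<alpha>..\<beta>} x)
      (F \<beta> * a \<beta> - F \<alpha> * a \<alpha>)"
  proof (rule has_bochner_integral_FTC_Icc_real)
    fix x assume x: "\<alpha> \<le> x" "x \<le> \<beta>"
    then have "x \<in> S" using ab(2) by auto
    then show "((\<lambda>x. F x * a x) has_real_derivative F x * deriv a x + F' x * a x) (at x)"
      using DERIV_mult[OF F(1) da] by (simp add: algebra_simps)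
    show "isCont (\<lambda>x. F x * deriv a x + F' x * a x) x"
      using x by (intro continuous_intros cont) auto
  qed (use ab in simp)
  have 1: "has_bochner_integral lborel (\<lambda>x. F x * deriv a x + g x * a x) 0"
    using w a unfolding weak_deriv_def has_bochner_integral_iff
    by (auto intro!: Bochner_Integration.integrable_add locally_integrable_mult[OF _ ca(1) compact_Icc a0(2)]
        locally_integrable_mult[OF _ ca(2) compact_Icc a0(1)])
  have "has_bochner_integral lborel (\<lambda>x. (F x * deriv a x + F' x * a x) * indicator {\<alpha>..\<beta>} x
       - (F x * deriv a x + g x * a x)) (F \<beta> * a \<beta> - F \<alpha> * a \<alpha> - 0)"
    by (intro has_bochner_integral_diff FTC 1)
  moreover have "(F x * deriv a x + F' x * a x) * indicator {\<alpha>..\<beta>} x - (F x * deriv a x + g x * a x)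
     = H x * a x" for x
    using a0[of x] G(2)[of x] ab(2) by (cases "x \<in> {\<alpha>..\<beta>}") (auto simp: H_def algebra_simps)
  moreover have "F \<beta> * a \<beta> - F \<alpha> * a \<alpha> - 0 = 0"
    by (simp add: a_def bump_zero)
  ultimately have "has_bochner_integral lborel (\<lambda>x. H x * a x) 0" by simp
  from has_bochner_integral_mult_right[OF this, of \<sigma>]
  have i: "integrable lborel (\<lambda>x. \<sigma> * H x * a x)" "(\<integral>x. \<sigma> * H x * a x \<partial>lborel) = 0"
    by (simp_all add: has_bochner_integral_iff mult.assoc)
  have nn: "\<sigma> * H x * a x \<ge> 0" for x
    using ab(3)[of x] a0(1)[of x] bump_nonneg[of \<alpha> \<beta> x] by (cases "x \<in> {\<alpha>..\<beta>}") (auto simp: a_def)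
  have "AE x in lborel. \<sigma> * H x * a x = 0"
    using i integral_nonneg_eq_0_iff_AE[OF i(1)] nn by simp
  then have "AE x in lborel. x \<notin> {\<alpha><..<\<beta>}"
  proof eventually_elim
    case (elim x)
    then show ?case
      using ab(3)[of x] bump_pos_iff[of \<alpha> \<beta> x] by (auto simp: a_def)
  qed
  then show False using not_AE_notin_Ioo ab(1) by blast
qed

text \<open>A jump of \<open>F\<close> would put an atom into the distribution \<open>g\<close>: test against \<open>a (n * x)\<close> for a bump
  \<open>a\<close> around \<open>0\<close> and let \<open>n\<close> tend to infinity.\<close>

lemma weak_deriv_no_jump:
  assumes w: "weak_deriv F g"
    and l: "(F \<longlongrightarrow> l) (at_left 0)" and r: "(F \<longlongrightarrow> r) (at_right 0)"
  shows "l = r"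
proof -
  define a where "a = bump (-1) 1"
  have a: "test_function a" unfolding a_def by (rule test_function_bump)
  note da = test_function_real(1)[OF a] and ca = test_function_real(2,3)[OF a]
  have a0: "a x = 0" "deriv a x = 0" if "x \<notin> {-1..1}" for x
    using that deriv_bump_zero by (auto simp: a_def intro: bump_zero)
  have [measurable]: "a \<in> borel_measurable lborel" "deriv a \<in> borel_measurable lborel"
    using ca by (simp_all add: borel_measurable_continuous_onI)
  obtain C where C: "\<And>x. \<bar>a x\<bar> \<le> C" "\<And>x. \<bar>deriv a x\<bar> \<le> C"
  proof -
    have "compact (a ` {-1..1})" "compact (deriv a ` {-1..1})"
      using ca by (auto intro!: compact_continuous_image intro: continuous_on_subset)
    then obtain C1 C2 where "\<And>x. x \<in> {-1..1} \<Longrightarrow> \<bar>a x\<bar> \<le> C1" "\<And>x. x \<in> {-1..1} \<Longrightarrow> \<bar>deriv a x\<bar> \<le> C2"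
      by (force dest!: compact_imp_bounded simp: bounded_iff)
    then have "\<bar>a x\<bar> \<le> \<bar>C1\<bar> + \<bar>C2\<bar>" "\<bar>deriv a x\<bar> \<le> \<bar>C1\<bar> + \<bar>C2\<bar>" for x
      using a0[of x] by (cases "x \<in> {-1..1}"; fastforce)+
    then show ?thesis by (rule that)
  qed
  have li: "locally_integrable F" "locally_integrable g" using w by (auto simp: weak_deriv_def)
  define c where "c = (\<lambda>n x. a (real (Suc n) * x))"
  have c: "test_function (c n)" for n
    using test_function_scale[OF a] by (simp add: c_def)
  have c0: "c n x = 0" "deriv (c n) x = 0" if "x \<notin> {-1..1}" for n x
  proof -
    have "real (Suc n) * x \<notin> {-1..1}"
    proof -
      have "1 * \<bar>x\<bar> \<le> real (Suc n) * \<bar>x\<bar>" by (intro mult_right_mono) auto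
      moreover have "\<bar>x\<bar> > 1" using that by auto
      ultimately have "\<bar>real (Suc n) * x\<bar> > 1" by (simp only: abs_mult abs_of_nat)
      then show ?thesis by auto
    qed
    with a0 show "c n x = 0" by (simp only: c_def)
    from \<open>real (Suc n) * x \<notin> {-1..1}\<close> a0 show "deriv (c n) x = 0"
      using DERIV_imp_deriv[OF DERIV_chain2[OF da[of "real (Suc n) * x"] DERIV_cmult_Id]]
      by (simp add: c_def)
  qed
  have dc: "deriv (c n) x = deriv a (real (Suc n) * x) * real (Suc n)" for n x
    using DERIV_imp_deriv[OF DERIV_chain2[OF da[of "real (Suc n) * x"] DERIV_cmult_Id]]
    by (simp add: c_def)
  note cc = test_function_real(2,3)[OF c]
  have ii: "integrable lborel (\<lambda>x. F x * deriv (c n) x)" "integrable lborel (\<lambda>x. g x * c n x)" for n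
    by (rule locally_integrable_mult[OF li(1) cc(1) compact_Icc c0(2)]
        locally_integrable_mult[OF li(2) cc(2) compact_Icc c0(1)], assumption)+
  have eq: "(\<integral>x. F x * deriv (c n) x \<partial>lborel) = - (\<integral>x. g x * c n x \<partial>lborel)" for n
  proof -
    have "(\<integral>x. F x * deriv (c n) x + g x * c n x \<partial>lborel) = 0"
      using w c by (simp add: weak_deriv_def)
    then show ?thesis using ii[of n] by simp
  qed
  have ae0: "AE x in lborel. x \<noteq> (0::real)" by (rule AE_lborel_singleton)
  \<comment> \<open>The supports of \<open>c n\<close> shrink to a point while the functions stay
    bounded by \<open>C\<close>, so the contribution of a locally integrable \<open>g\<close>
    disappears.\<close>
  have lim1: "(\<lambda>n. \<integral>x. g x * c n x \<partial>lborel) \<longlonglongrightarrow> (\<integral>x. 0 \<partial>(lborel::real measure))"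
  proof (rule integral_dominated_convergence)
    have gi: "integrable lborel (\<lambda>x. indicator {-1..1} x * g x)"
      using li(2) by (simp add: locally_integrable_def set_integrable_def)
    then show "integrable lborel (\<lambda>x. C * \<bar>indicator {-1..1} x * g x\<bar>)" by simp
    show "(\<lambda>x. g x * c n x) \<in> borel_measurable lborel" for n
      using ii(2) by (rule borel_measurable_integrable)
    show "AE x in lborel. norm (g x * c n x) \<le> C * \<bar>indicator {-1..1} x * g x\<bar>" for n
    proof (rule AE_I2)
      fix x
      show "norm (g x * c n x) \<le> C * \<bar>indicator {-1..1} x * g x\<bar>"
        using c0[of x n] mult_right_mono[OF C(1)[of "real (Suc n) * x"], of "\<bar>g x\<bar>"]
        by (cases "x \<in> {-1..1}") (auto simp: abs_mult c_def mult.commute)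
    qed
    show "AE x in lborel. (\<lambda>n. g x * c n x) \<longlonglongrightarrow> 0"
      using ae0
    proof eventually_elim
      case (elim x)
      have "filterlim (\<lambda>n. real (Suc n) * \<bar>x\<bar>) at_top sequentially"
        using elim by (intro filterlim_at_top_mult_tendsto_pos[OF tendsto_const]
            filterlim_compose[OF filterlim_real_sequentially filterlim_Suc]) simp
      then have "\<forall>\<^sub>F n in sequentially. real (Suc n) * \<bar>x\<bar> > 1"
        by (simp add: filterlim_at_top_dense)
      then have "\<forall>\<^sub>F n in sequentially. g x * c n x = 0"
      proof eventually_elim
        case (elim n)
        then have "\<bar>real (Suc n) * x\<bar> > 1" by (simp only: abs_mult abs_of_nat)
        then have "real (Suc n) * x \<notin> {-1..1}" by auto
        then show ?case using a0 by (simp add: c_def)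
      qed
      then show ?case by (rule tendsto_eventually)
    qed
  qed simp
  \<comment> \<open>Substituting \<open>x = y / (n + 1)\<close> absorbs the factor
    \<open>n + 1\<close> produced by differentiating \<open>c n\<close>: the jump term does not
    decay, in contrast to the term with \<open>g\<close>.\<close>
  have eq2: "(\<integral>x. F x * deriv (c n) x \<partial>lborel) = (\<integral>y. F (y / real (Suc n)) * deriv a y \<partial>lborel)" for n
    using lborel_integral_real_affine[of "1 / real (Suc n)" "\<lambda>x. F x * deriv (c n) x" 0]
    by (simp add: dc mult.assoc[symmetric] del: of_nat_Suc)
  define L where "L = (\<lambda>y::real. if y < 0 then l else r)"
  obtain \<delta> B where \<delta>: "\<delta> > 0" and B: "\<And>x. x \<noteq> 0 \<Longrightarrow> \<bar>x\<bar> < \<delta> \<Longrightarrow> \<bar>F x\<bar> \<le> B"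
  proof -
    have "\<forall>\<^sub>F x in at_left 0. \<bar>F x\<bar> < \<bar>l\<bar> + 1" "\<forall>\<^sub>F x in at_right 0. \<bar>F x\<bar> < \<bar>r\<bar> + 1"
      using tendsto_rabs[OF l] tendsto_rabs[OF r] by (auto intro: order_tendstoD)
    then have "\<forall>\<^sub>F x in at_left 0. \<bar>F x\<bar> \<le> \<bar>l\<bar> + \<bar>r\<bar> + 1" "\<forall>\<^sub>F x in at_right 0. \<bar>F x\<bar> \<le> \<bar>l\<bar> + \<bar>r\<bar> + 1"
      by (auto elim: eventually_mono)
    then have "\<forall>\<^sub>F x in at 0. \<bar>F x\<bar> \<le> \<bar>l\<bar> + \<bar>r\<bar> + 1"
      by (simp add: eventually_at_split)
    then show ?thesis
      using that by (auto simp: eventually_at dist_real_def)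
  qed
  \<comment> \<open>\<open>F\<close> is bounded only near 0. Starting the sequence at
    \<open>N\<close> puts all points \<open>y / (n + N + 1)\<close> with
    \<open>\<bar>y\<bar> \<le> 1\<close> into that neighbourhood.\<close>
  obtain N where N: "1 / real (Suc N) < \<delta>" using \<delta> nat_approx_posE by blast
  have lim2: "(\<lambda>n. \<integral>y. F (y / real (Suc (n + N))) * deriv a y \<partial>lborel) \<longlonglongrightarrow> (\<integral>y. L y * deriv a y \<partial>lborel)"
  proof (rule integral_dominated_convergence)
    show "(\<lambda>y. L y * deriv a y) \<in> borel_measurable lborel" unfolding L_def by measurable
    show "(\<lambda>y. F (y / real (Suc (n + N))) * deriv a y) \<in> borel_measurable lborel" for n
    proof -
      have "(\<lambda>y. F (0 + 1 / real (Suc (n + N)) * y) * deriv (c (n + N)) (0 + 1 / real (Suc (n + N)) * y)) \<in> borel_measurable lborel"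
        using ii(1)[of "n + N"] by (intro borel_measurable_integrable lborel_integrable_real_affine) auto
      then have "(\<lambda>y. F (y / real (Suc (n + N))) * deriv a y * real (Suc (n + N))) \<in> borel_measurable lborel"
        by (simp add: dc mult.assoc del: of_nat_Suc)
      then have "(\<lambda>y. F (y / real (Suc (n + N))) * deriv a y * real (Suc (n + N)) / real (Suc (n + N))) \<in> borel_measurable lborel"
        by (intro borel_measurable_divide borel_measurable_const)
      then show ?thesis by (simp del: of_nat_Suc)
    qed
    show "integrable lborel (\<lambda>y::real. B * (indicator {-1..1} y * C))"
      by (intro integrable_mult_right integrable_mult_left integrable_real_indicator) auto
    show "AE y in lborel. norm (F (y / real (Suc (n + N))) * deriv a y) \<le> B * (indicator {-1..1} y * C)" for n
      using ae0
    proof eventually_elim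
      case (elim y)
      show ?case
      proof (cases "y \<in> {-1..1}")
        case True
        have "\<bar>y / real (Suc (n + N))\<bar> \<le> 1 / real (Suc N)"
          using True by (auto simp: abs_divide simp del: of_nat_Suc intro!: frac_le)
        then have "\<bar>F (y / real (Suc (n + N)))\<bar> \<le> B"
          using N elim by (intro B) (auto simp del: of_nat_Suc)
        then have "\<bar>F (y / real (Suc (n + N)))\<bar> * \<bar>deriv a y\<bar> \<le> B * C"
          using C(2)[of y] by (intro mult_mono) auto
        with True show ?thesis by (simp add: abs_mult)
      qed (use a0 in simp)
    qed
    show "AE y in lborel. (\<lambda>n. F (y / real (Suc (n + N))) * deriv a y) \<longlonglongrightarrow> L y * deriv a y"
      using ae0
    proof eventually_elim
      case (elim y)
      have "filterlim (\<lambda>n. real (Suc (n + N))) at_top sequentially"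
        using filterlim_compose[OF filterlim_real_sequentially filterlim_add_const_nat_at_top[of "Suc N"]] by simp
      from tendsto_divide_0[OF tendsto_const[of y] filterlim_at_top_imp_at_infinity[OF this]]
      have 0: "(\<lambda>n. y / real (Suc (n + N))) \<longlonglongrightarrow> 0" .
      have "(\<lambda>n. F (y / real (Suc (n + N)))) \<longlonglongrightarrow> L y"
      proof (cases "y < 0")
        case True
        then have "filterlim (\<lambda>n. y / real (Suc (n + N))) (at_left 0) sequentially"
          using 0 by (auto simp: filterlim_at divide_neg_pos simp del: of_nat_Suc)
        from filterlim_compose[OF l this] True show ?thesis by (simp add: L_def)
      next
        case False
        then have "filterlim (\<lambda>n. y / real (Suc (n + N))) (at_right 0) sequentially"
          using 0 elim by (auto simp: filterlim_at divide_pos_pos simp del: of_nat_Suc)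
        from filterlim_compose[OF r this] False show ?thesis by (simp add: L_def)
      qed
      then show ?case by (intro tendsto_intros)
    qed
  qed
  have "(\<lambda>n. \<integral>y. F (y / real (Suc (n + N))) * deriv a y \<partial>lborel) \<longlonglongrightarrow> 0"
  proof -
    have "(\<lambda>n. \<integral>x. g x * c (n + N) x \<partial>lborel) \<longlonglongrightarrow> 0"
      using LIMSEQ_ignore_initial_segment[OF lim1, of N] by simp
    from tendsto_minus[OF this] show ?thesis
      unfolding eq2[symmetric] eq by simp
  qed
  with lim2 have L0: "(\<integral>y. L y * deriv a y \<partial>lborel) = 0"
    using LIMSEQ_unique by blast
  \<comment> \<open>Since \<open>a\<close> vanishes at -1 and 1, the two one-sided integrals of
    \<open>L * deriv a\<close> add up to \<open>(l - r) * a 0\<close>, and \<open>a 0\<close> is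
    positive.\<close>
  have "has_bochner_integral lborel (\<lambda>y. deriv a y * indicator {-1..0} y) (a 0 - a (-1))"
    "has_bochner_integral lborel (\<lambda>y. deriv a y * indicator {0..1} y) (a 1 - a 0)"
    using da ca by (auto intro!: has_bochner_integral_FTC_Icc_real simp: continuous_on_eq_continuous_at)
  from has_bochner_integral_add[OF has_bochner_integral_mult_right[OF this(1), of l]
      has_bochner_integral_mult_right[OF this(2), of r]]
  have "(\<integral>y. l * (deriv a y * indicator {-1..0} y) + r * (deriv a y * indicator {0..1} y) \<partial>lborel) =
      l * (a 0 - a (-1)) + r * (a 1 - a 0)"
    by (simp add: has_bochner_integral_iff)
  also have "(\<integral>y. l * (deriv a y * indicator {-1..0} y) + r * (deriv a y * indicator {0..1} y) \<partial>lborel) =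
      (\<integral>y. L y * deriv a y \<partial>lborel)"
  proof (rule integral_cong_AE)
    show "AE y in lborel. l * (deriv a y * indicator {-1..0} y) + r * (deriv a y * indicator {0..1} y) = L y * deriv a y"
      using ae0
    proof eventually_elim
      case (elim y)
      then show ?case using a0(2)[of y] by (cases "y \<in> {-1..1}") (auto simp: L_def indicator_def)
    qed
  qed (unfold L_def, measurable)
  finally have "(l - r) * a 0 = 0"
    using L0 by (auto simp: a_def bump_zero algebra_simps)
  moreover have "a 0 > 0" by (simp add: a_def bump_pos_iff)
  ultimately show ?thesis by simp
qed

section \<open>The detonation profile\<close>

text \<open>The set of agreement is closed by continuity and open by \<open>step\<close>. In
  \<open>step\<close> equality at the point may be assumed, so an equation known only for values
  near those of \<open>g\<close> still suffices to propagate the solution.\<close>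

lemma continuous_eq_on_connected:
  fixes f g :: "'a::metric_space \<Rightarrow> 'b::metric_space"
  assumes S: "open S" "connected S" and f: "continuous_on S f" and g: "continuous_on S g"
    and x0: "x0 \<in> S" "f x0 = g x0"
    and step: "\<And>x. x \<in> S \<Longrightarrow> f x = g x \<Longrightarrow> \<forall>\<^sub>F y in nhds x. f y = g y"
    and x: "x \<in> S"
  shows "f x = g x"
proof (rule ccontr)
  assume ne: "f x \<noteq> g x"
  define U V where "U = {x \<in> S. f x = g x}" and "V = {x \<in> S. f x \<noteq> g x}"
  have "open U"
  proof (subst open_subopen, intro ballI)
    fix y assume y: "y \<in> U"
    have "\<forall>\<^sub>F z in nhds y. z \<in> S \<and> f z = g z"
      using y step[of y] S(1) by (auto simp: U_def intro: eventually_conj eventually_nhds_in_open)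
    then show "\<exists>T. open T \<and> y \<in> T \<and> T \<subseteq> U"
      by (auto simp: eventually_nhds U_def)
  qed
  moreover have "open V"
  proof -
    have "continuous_on S (\<lambda>x. dist (f x) (g x))" by (intro continuous_intros f g)
    then have "open ((\<lambda>x. dist (f x) (g x)) -` {0<..} \<inter> S)"
      using S(1) by (auto simp: continuous_on_open_vimage)
    moreover have "(\<lambda>x. dist (f x) (g x)) -` {0<..} \<inter> S = V" by (auto simp: V_def)
    ultimately show ?thesis by simp
  qed
  ultimately show False
    using connectedD[OF S(2), of U V] x0 x ne by (auto simp: U_def V_def)
qed

lemma locally_integrable_add:
  fixes f g :: "'a::euclidean_space \<Rightarrow> real"
  shows "locally_integrable f \<Longrightarrow> locally_integrable g \<Longrightarrow> locally_integrable (\<lambda>x. f x + g x)"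
  by (simp add: locally_integrable_def)

lemma locally_integrable_cmult:
  fixes f :: "'a::euclidean_space \<Rightarrow> real"
  shows "locally_integrable f \<Longrightarrow> locally_integrable (\<lambda>x. c * f x)"
  by (simp add: locally_integrable_def)

text \<open>On functions of \<open>x - s * t\<close> the time derivative is \<open>- s\<close> times
  the derivative in \<open>\<xi>\<close>; the conservation law thus becomes constancy of a flux, and
  the reaction law becomes \<open>s z' = k \<phi>(u) z\<close>.\<close>

lemma strong_znd_detonation_weak_deriv:
  assumes "strong_znd_detonation q k \<phi> s um up ub zb"
  shows "weak_deriv (\<lambda>x. (ub x)\<^sup>2 / 2 - s * (ub x + q * zb x)) (\<lambda>x. 0)"
    and "weak_deriv (\<lambda>x. s * zb x) (\<lambda>x. k * \<phi> (ub x) * zb x)"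
proof -
  have w: "majda_weak_solution q k \<phi> (\<lambda>(x, t). ub (x - s * t)) (\<lambda>(x, t). zb (x - s * t))"
    using assms by (simp add: strong_znd_detonation_def)
  note W = majda_weak_solution_travelling_wave[OF w]
  have a: "test_function (bump 0 1)" by (rule test_function_bump)
  note L = W(3-)[OF a]
  have "locally_integrable (\<lambda>x. 1 / 2 * (ub x)\<^sup>2 + (- s) * (ub x + q * zb x))"
    "locally_integrable (\<lambda>x. s * zb x)" "locally_integrable (\<lambda>x. k * (\<phi> (ub x) * zb x))"
    "locally_integrable (\<lambda>x::real. 0)"
    by (intro L locally_integrable_add locally_integrable_cmult locally_integrable_continuous continuous_on_const)+
  with W(1,2) show "weak_deriv (\<lambda>x. (ub x)\<^sup>2 / 2 - s * (ub x + q * zb x)) (\<lambda>x. 0)"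
    "weak_deriv (\<lambda>x. s * zb x) (\<lambda>x. k * \<phi> (ub x) * zb x)"
    by (simp_all add: weak_deriv_def mult.assoc)
qed

text \<open>The flux is constant on each side, its two constants agree by the absence of a jump (the
  Rankine-Hugoniot condition), and the endstate at \<open>+\<infinity>\<close> fixes the value.
  Completing the square gives this form. The conservation law does not involve the ignition
  function, so the relation is available before the location of \<open>u\<close> is known.\<close>

lemma strong_znd_detonation_flux:
  assumes wave: "strong_znd_detonation q k \<phi> s um up ub zb" and "\<xi> \<noteq> 0"
  shows "(ub \<xi> - s)\<^sup>2 = (s - up)\<^sup>2 - 2 * q * s * (1 - zb \<xi>)"
proof -
  define F where "F = (\<lambda>x. (ub x)\<^sup>2 / 2 - s * (ub x + q * zb x))"
  have sm: "smooth_on (- {0}) ub" "smooth_on (- {0}) zb"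
    using wave by (auto simp: strong_znd_detonation_def)
  then have "Ck_on (Suc 0) (- {0}) ub" "Ck_on (Suc 0) (- {0}) zb"
    unfolding smooth_on_def by blast+
  then obtain du dz where d: "\<And>x. x \<in> - {0} \<Longrightarrow> (ub has_real_derivative du x) (at x)" "continuous_on (- {0}) du"
      "\<And>x. x \<in> - {0} \<Longrightarrow> (zb has_real_derivative dz x) (at x)" "continuous_on (- {0}) dz"
    by (elim Ck_on_1_real_deriv) blast
  have c: "continuous_on (- {0}) ub" "continuous_on (- {0}) zb"
    using sm[unfolded smooth_on_def, THEN spec[of _ 0]] by simp_all
  have dF: "(F has_real_derivative ub x * du x - s * (du x + q * dz x)) (at x)" if "x \<in> - {0}" for x
    unfolding F_def using d(1)[OF that] d(3)[OF that]
    by (auto intro!: derivative_eq_intros simp: field_simps)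
  have dF0: "ub x * du x - s * (du x + q * dz x) = 0" if "x \<in> - {0}" for x
    using weak_deriv_eq_deriv[OF strong_znd_detonation_weak_deriv(1)[OF wave], of "- {0}" x
       "\<lambda>x. ub x * du x - s * (du x + q * dz x)" "\<lambda>_. 0"] that dF
    by (fastforce simp: F_def intro!: continuous_intros c d)
  have D0: "(F has_real_derivative 0) (at x)" if "x \<in> - {0}" for x
    using dF[OF that] dF0[OF that] by simp
  have "\<exists>c. \<forall>x\<in>{0<..}. F x = c"
    by (rule has_field_derivative_zero_constant) (auto intro!: DERIV_subset[OF D0])
  then obtain cr where cr: "\<And>x. x > 0 \<Longrightarrow> F x = cr" by auto
  have "\<exists>c. \<forall>x\<in>{..<0}. F x = c"
    by (rule has_field_derivative_zero_constant) (auto intro!: DERIV_subset[OF D0])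
  then obtain cl where cl: "\<And>x. x < 0 \<Longrightarrow> F x = cl" by auto
  have "(F \<longlongrightarrow> up\<^sup>2 / 2 - s * (up + q * 1)) at_top"
    unfolding F_def using wave by (intro tendsto_intros) (auto simp: strong_znd_detonation_def)
  moreover have "(F \<longlongrightarrow> cr) at_top"
    using cr by (auto intro!: tendsto_eventually eventually_mono[OF eventually_gt_at_top[of 0]])
  ultimately have "cr = up\<^sup>2 / 2 - s * (up + q)"
    using tendsto_unique[of at_top F] by force
  moreover have "cl = cr"
  proof (rule weak_deriv_no_jump)
    show "weak_deriv F (\<lambda>x. 0)"
      using strong_znd_detonation_weak_deriv(1)[OF wave] by (simp add: F_def)
    show "(F \<longlongrightarrow> cl) (at_left 0)" "(F \<longlongrightarrow> cr) (at_right 0)"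
      using cl cr by (auto intro!: tendsto_eventually simp: eventually_at_filter)
  qed
  moreover have "F \<xi> = cl \<or> F \<xi> = cr"
    using cl[of \<xi>] cr[of \<xi>] \<open>\<xi> \<noteq> 0\<close> by linarith
  ultimately have "F \<xi> = up\<^sup>2 / 2 - s * (up + q)" by blast
  then show ?thesis by (simp add: F_def power2_eq_square field_simps)
qed

text \<open>With \<open>\<phi>\<close> frozen at \<open>c\<close> the reaction law is a linear
  scalar equation, solved by an integrating factor. It is used with \<open>c = 0\<close> ahead of
  the shock, where \<open>z\<close> becomes constant, and with \<open>c = 1\<close> behind
  it.\<close>

lemma strong_znd_detonation_reactant:
  assumes wave: "strong_znd_detonation q k \<phi> s um up ub zb" and "s > 0"
    and S: "open S" "convex S" "S \<subseteq> - {0}" and \<phi>: "\<And>x. x \<in> S \<Longrightarrow> \<phi> (ub x) = c"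
  shows "\<exists>C. \<forall>x\<in>S. zb x = C * exp (k * c / s * x)"
proof -
  have sm: "smooth_on (- {0}) zb"
    using wave by (auto simp: strong_znd_detonation_def)
  then have "Ck_on (Suc 0) (- {0}) zb"
    unfolding smooth_on_def by blast
  then obtain dz where d: "\<And>x. x \<in> - {0} \<Longrightarrow> (zb has_real_derivative dz x) (at x)" "continuous_on (- {0}) dz"
    by (rule Ck_on_1_real_deriv) blast
  have cz: "continuous_on (- {0}) zb"
    using sm[unfolded smooth_on_def, THEN spec[of _ 0]] by simp
  have dS: "(zb has_real_derivative dz x) (at x)" if "x \<in> S" for x
    using d(1)[OF subsetD[OF S(3) that]] .
  have dz: "s * dz x = k * c * zb x" if "x \<in> S" for x
  proof -
    have 1: "((\<lambda>x. s * zb x) has_real_derivative s * dz x) (at x)" if "x \<in> S" for x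
      using dS[OF that] by (rule DERIV_cmult)
    have 2: "continuous_on S (\<lambda>x. s * dz x)" "continuous_on S (\<lambda>x. k * c * zb x)"
      by (rule continuous_on_mult_left continuous_on_subset[OF d(2) S(3)] continuous_on_subset[OF cz S(3)])+
    have 3: "k * \<phi> (ub x) * zb x = k * c * zb x" if "x \<in> S" for x
      using \<phi>[OF that] by simp
    show ?thesis
      using weak_deriv_eq_deriv[OF strong_znd_detonation_weak_deriv(2)[OF wave] \<open>open S\<close> that 1 2 3]
      by simp
  qed
  have "((\<lambda>x. zb x * exp (- (k * c / s) * x)) has_real_derivative 0) (at x within S)" if "x \<in> S" for x
  proof -
    have "((\<lambda>x. zb x * exp (- (k * c / s) * x)) has_real_derivative
       dz x * exp (- (k * c / s) * x) + exp (- (k * c / s) * x) * - (k * c / s) * zb x) (at x)"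
      by (intro DERIV_mult DERIV_chain2[OF DERIV_exp DERIV_cmult_Id] dS that)
    moreover have "dz x = k * c / s * zb x"
      using dz[OF that] \<open>s > 0\<close> by (simp add: field_simps)
    then have "dz x * exp (- (k * c / s) * x) + exp (- (k * c / s) * x) * - (k * c / s) * zb x = 0"
      by (simp only:) (simp only: mult_minus_right mult_minus_left mult_ac add.right_inverse)
    ultimately show ?thesis
      by (simp only: has_field_derivative_at_within)
  qed
  from has_field_derivative_zero_constant[OF S(2) this]
  obtain C where C: "\<And>x. x \<in> S \<Longrightarrow> zb x * exp (- (k * c / s) * x) = C" by blast
  have "zb x = C * exp (k * c / s * x)" if "x \<in> S" for x
  proof -
    have "C * exp (k * c / s * x) = zb x * exp (- (k * c / s) * x + k * c / s * x)"
      unfolding C[OF that, symmetric] by (simp only: exp_add mult.assoc)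
    then show ?thesis by simp
  qed
  then show ?thesis by (intro exI[of _ C] ballI)
qed

text \<open>Near \<open>+\<infinity>\<close> the state lies in \<open>N\<close>, so \<open>z\<close>
  is constant and equals its limit 1; the flux relation then leaves two roots symmetric about
  \<open>s\<close>, and \<open>u < s\<close> selects \<open>up\<close>. Continuation carries this
  down to the shock: a state equal to \<open>up\<close> stays in \<open>N\<close> and below
  \<open>s\<close> nearby.\<close>

lemma strong_znd_detonation_quiescent:
  assumes wave: "strong_znd_detonation q k \<phi> s um up ub zb"
    and N: "open N" "up \<in> N" "\<And>u. u \<in> N \<Longrightarrow> \<phi> u = 0" and "\<xi> > 0"
  shows "ub \<xi> = up \<and> zb \<xi> = 1"
proof -
  have s: "up < s" "s > 0" and sm: "smooth_on (- {0}) ub" "smooth_on (- {0}) zb"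
    and lim: "(ub \<longlongrightarrow> up) at_top" "(zb \<longlongrightarrow> 1) at_top"
    using wave by (auto simp: strong_znd_detonation_def)
  have c: "continuous_on {0<..} ub" "continuous_on {0<..} zb"
    using sm[unfolded smooth_on_def, THEN spec[of _ 0]] by (auto intro: continuous_on_subset)
  have z: "\<exists>C. \<forall>x\<in>S. zb x = C"
    if "open S" "convex S" "S \<subseteq> {0<..}" "\<And>x. x \<in> S \<Longrightarrow> ub x \<in> N" for S
    using strong_znd_detonation_reactant[OF wave \<open>s > 0\<close> that(1,2), of 0] that(3,4) N(3) by fastforce
  have u: "ub x = up" if "x > 0" "zb x = 1" "ub x < s" for x
  proof -
    have "(s - ub x)\<^sup>2 = (s - up)\<^sup>2"
      using strong_znd_detonation_flux[OF wave, of x] that by (simp add: power2_commute)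
    then have "s - ub x = s - up" using that s by (subst (asm) power2_eq_iff_nonneg) auto
    then show ?thesis by simp
  qed
  have "\<forall>\<^sub>F x in at_top. ub x \<in> N" "\<forall>\<^sub>F x in at_top. ub x < s"
    using topological_tendstoD[OF lim(1) N(1,2)] order_tendstoD(2)[OF lim(1) s(1)] by auto
  then have "\<forall>\<^sub>F x in at_top. ub x \<in> N \<and> ub x < s" by (rule eventually_conj)
  then obtain X where X: "\<And>x. x \<ge> X \<Longrightarrow> ub x \<in> N \<and> ub x < s"
    by (auto simp: eventually_at_top_linorder)
  \<comment> \<open>Truncated at 0 so that the half-line beyond \<open>Y\<close> avoids the
    shock.\<close>
  define Y where "Y = max X 0"
  obtain C where C: "\<And>x. x > Y \<Longrightarrow> zb x = C"
    using z[of "{Y<..}"] X by (auto simp: Y_def)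
  then have "(zb \<longlongrightarrow> C) at_top"
    by (auto intro!: tendsto_eventually eventually_mono[OF eventually_gt_at_top[of Y]])
  with lim(2) have "C = 1" using tendsto_unique[of at_top zb] by force
  have start: "zb (Y + 1) = 1" "ub (Y + 1) = up" "Y + 1 > 0"
    using C[of "Y + 1"] X[of "Y + 1"] \<open>C = 1\<close> u[of "Y + 1"] by (auto simp: Y_def)
  have "(zb \<xi>, ub \<xi>) = (1, up)"
  proof (rule continuous_eq_on_connected[of "{0<..}" "\<lambda>x. (zb x, ub x)" "\<lambda>x. (1, up)" "Y + 1"])
    fix x assume x: "x \<in> {0<..}" "(zb x, ub x) = (1, up)"
    have "isCont ub x" using c(1) x(1) by (simp add: continuous_on_eq_continuous_at)
    then have t: "(ub \<longlongrightarrow> up) (nhds x)"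
      using x(2) by (simp add: isCont_def tendsto_at_iff_tendsto_nhds)
    have "\<forall>\<^sub>F y in nhds x. ub y \<in> N \<and> ub y < s \<and> y \<in> {0<..}"
      using topological_tendstoD[OF t N(1,2)] order_tendstoD(2)[OF t s(1)] x(1)
      by (intro eventually_conj eventually_nhds_in_open) auto
    then obtain e where e: "e > 0" "\<And>y. y \<in> ball x e \<Longrightarrow> ub y \<in> N \<and> ub y < s \<and> y > 0"
      by (auto simp: eventually_nhds_metric dist_commute)
    then obtain C where C: "\<And>y. y \<in> ball x e \<Longrightarrow> zb y = C"
      using z[of "ball x e"] by fastforce
    have "C = 1" using C[of x] e x(2) by simp
    have "\<forall>\<^sub>F y in nhds x. y \<in> ball x e" using e by (intro eventually_nhds_in_open) auto
    then show "\<forall>\<^sub>F y in nhds x. (zb y, ub y) = (1, up)"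
    proof eventually_elim
      case (elim y)
      then show ?case using C[of y] e(2)[of y] u[of y] \<open>C = 1\<close> by simp
    qed
  qed (use c start \<open>\<xi> > 0\<close> in \<open>auto intro!: continuous_intros\<close>)
  then show ?thesis by simp
qed

text \<open>Integration starts at the shock, because the limit 0 of \<open>z\<close> at
  \<open>-\<infinity>\<close> does not fix the amplitude of the exponential, whereas continuity of
  \<open>z\<close> across the shock makes it 1.\<close>

lemma strong_znd_detonation_reaction_zone:
  assumes wave: "strong_znd_detonation q k \<phi> s um up ub zb"
    and pos: "q > 0" "k > 0" and CJ: "2 * q * s < (s - up)\<^sup>2"
    and N: "open N" "up \<in> N" "\<And>u. u \<in> N \<Longrightarrow> \<phi> u = 0"
    and M: "open M" "{u_minus q s up..u_star s up} \<subseteq> M" "\<And>u. u \<in> M \<Longrightarrow> \<phi> u = 1" and "\<xi> < 0"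
  shows "zb \<xi> = exp (k / s * \<xi>)"
    and "ub \<xi> = s + sqrt ((s - up)\<^sup>2 - 2 * q * s * (1 - exp (k / s * \<xi>)))"
    and "ub \<xi> > s" "ub \<xi> \<in> M"
    and "(ub \<longlongrightarrow> 2 * s - up) (at_left 0)"
proof -
  define h where "h = (\<lambda>x. sqrt ((s - up)\<^sup>2 - 2 * q * s * (1 - exp (k / s * x))))"
  have s: "up < s" "s > 0" and sm: "smooth_on (- {0}) ub" "smooth_on (- {0}) zb"
    using wave by (auto simp: strong_znd_detonation_def)
  have c: "continuous_on {..<0} ub" "continuous_on {..<0} zb"
    using sm[unfolded smooth_on_def, THEN spec[of _ 0]] by (auto intro: continuous_on_subset)
  have z: "\<exists>C. \<forall>x\<in>S. zb x = C * exp (k / s * x)"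
    if "open S" "convex S" "S \<subseteq> {..<0}" "\<And>x. x \<in> S \<Longrightarrow> ub x \<in> M" for S
    using strong_znd_detonation_reactant[OF wave \<open>s > 0\<close> that(1,2), of 1] that(3,4) M(3) by fastforce
  have u: "ub x = s + h x" if "x < 0" "zb x = exp (k / s * x)" "ub x > s" for x
  proof -
    have "(ub x - s)\<^sup>2 = (s - up)\<^sup>2 - 2 * q * s * (1 - exp (k / s * x))"
      using strong_znd_detonation_flux[OF wave, of x] that by simp
    from this[symmetric] have "h x = ub x - s" using that by (simp add: h_def)
    then show ?thesis by simp
  qed
  \<comment> \<open>The exponential runs through \<open>(0, 1)\<close>, so the candidate lies
    between the two values given by exponential 0 and 1, namely \<open>u_minus\<close> and
    \<open>u_star\<close>. Hence it never leaves the burning region.\<close>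
  have h: "s + h x > s" "s + h x \<in> {u_minus q s up..u_star s up}" if "x < 0" for x
  proof -
    have e: "0 < exp (k / s * x)" "exp (k / s * x) \<le> 1"
      using that pos s by (auto intro!: divide_nonpos_pos mult_nonneg_nonpos)
    have "0 < 2 * q * s * exp (k / s * x)" "2 * q * s * exp (k / s * x) \<le> 2 * q * s"
      using e pos s by (simp_all add: mult_left_le)
    then have 1: "0 < (s - up)\<^sup>2 - 2 * q * s" 
      "(s - up)\<^sup>2 - 2 * q * s \<le> (s - up)\<^sup>2 - 2 * q * s * (1 - exp (k / s * x))"
      "(s - up)\<^sup>2 - 2 * q * s * (1 - exp (k / s * x)) \<le> (s - up)\<^sup>2"
      using CJ by (simp_all add: algebra_simps)
    then show "s + h x > s" by (simp add: h_def)
    have "sqrt ((s - up)\<^sup>2 - 2 * q * s) \<le> h x" "h x \<le> s - up"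
      using 1 s by (auto simp: h_def intro!: real_le_lsqrt)
    then show "s + h x \<in> {u_minus q s up..u_star s up}"
      by (simp add: u_minus_def u_star_def power2_diff algebra_simps)
  qed
  obtain ul ur where ul: "(ub \<longlongrightarrow> ul) (at_left 0)" and ur: "(ub \<longlongrightarrow> ur) (at_right 0)" and "ul \<noteq> ur"
    using wave by (auto simp: strong_znd_detonation_def)
  obtain zl zr where zl: "(zb \<longlongrightarrow> zl) (at_left 0)" and zr: "(zb \<longlongrightarrow> zr) (at_right 0)"
    using wave by (auto simp: strong_znd_detonation_def)
  have "ub x = up \<and> zb x = 1" if "x > 0" for x
    using strong_znd_detonation_quiescent[OF wave N that] .
  then have "(ub \<longlongrightarrow> up) (at_right 0)" "(zb \<longlongrightarrow> 1) (at_right 0)"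
    by (auto intro!: tendsto_eventually simp: eventually_at_filter)
  with ur zr have "ur = up" "zr = 1"
    using tendsto_unique[of "at_right (0::real)"] by force+
  \<comment> \<open>The reaction law expresses the weak derivative of \<open>s * zb\<close> by a
    locally integrable function, so the reactant cannot jump even though \<open>u\<close>
    does.\<close>
  have "s * zl = s * zr"
    by (rule weak_deriv_no_jump[OF strong_znd_detonation_weak_deriv(2)[OF wave]]; intro tendsto_intros zl zr)
  with s \<open>zr = 1\<close> have "zl = 1" by simp
  have A: "((\<lambda>x. (ub x - s)\<^sup>2) \<longlongrightarrow> (ul - s)\<^sup>2) (at_left 0)"
    and B: "((\<lambda>x. (s - up)\<^sup>2 - 2 * q * s * (1 - zb x)) \<longlongrightarrow> (s - up)\<^sup>2 - 2 * q * s * (1 - zl)) (at_left 0)"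
    by (intro tendsto_intros ul zl)+
  have "\<forall>\<^sub>F x in at_left 0. (ub x - s)\<^sup>2 = (s - up)\<^sup>2 - 2 * q * s * (1 - zb x)"
    using strong_znd_detonation_flux[OF wave] by (auto simp: eventually_at_filter)
  from tendsto_unique[OF trivial_limit_at_left_real Lim_transform_eventually[OF A this] B]
  have "(ul - s)\<^sup>2 = (s - up)\<^sup>2 - 2 * q * s * (1 - zl)" .
  \<comment> \<open>With \<open>zl = 1\<close> the flux relation has the roots \<open>up\<close> and
    \<open>2 * s - up\<close>; the first would mean no shock.\<close>
  then have ul_eq: "ul = 2 * s - up"
    using \<open>zl = 1\<close> \<open>ul \<noteq> ur\<close> \<open>ur = up\<close> by (auto simp: power2_eq_iff)
  moreover have "u_minus q s up \<le> u_star s up" using h(2)[of "-1"] by simp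
  ultimately have "ul \<in> M" "ul > s" using M(2) s by (auto simp: u_star_def)
  then have "\<forall>\<^sub>F x in at_left 0. ub x \<in> M \<and> ub x > s"
    using topological_tendstoD[OF ul M(1)] order_tendstoD(1)[OF ul] by (simp add: eventually_conj)
  then obtain b where b: "b < 0" "\<And>x. b < x \<Longrightarrow> x < 0 \<Longrightarrow> ub x \<in> M \<and> ub x > s"
    by (auto simp: eventually_at_left_field)
  have "\<exists>C. \<forall>x\<in>{b<..<0}. zb x = C * exp (k / s * x)"
    by (rule z) (use b in auto)
  then obtain C where C: "\<And>x. b < x \<Longrightarrow> x < 0 \<Longrightarrow> zb x = C * exp (k / s * x)"
    by auto
  have "((\<lambda>x. C * exp (k / s * x)) \<longlongrightarrow> C * exp (k / s * 0)) (at_left 0)"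
    by (intro tendsto_intros)
  moreover have "\<forall>\<^sub>F x in at_left 0. C * exp (k / s * x) = zb x"
    using C b(1) by (auto simp: eventually_at_left_field)
  ultimately have "(zb \<longlongrightarrow> C * exp (k / s * 0)) (at_left 0)" by (rule Lim_transform_eventually)
  with zl \<open>zl = 1\<close> have "C = 1" using tendsto_unique[of "at_left (0::real)" zb] by force
  have start: "b / 2 < 0" "zb (b / 2) = exp (k / s * (b / 2))" "ub (b / 2) = s + h (b / 2)"
    using C[of "b / 2"] b \<open>C = 1\<close> u[of "b / 2"] by auto
  have "(zb \<xi>, ub \<xi>) = (exp (k / s * \<xi>), s + h \<xi>)"
  proof (rule continuous_eq_on_connected[of "{..<0}" "\<lambda>x. (zb x, ub x)"
        "\<lambda>x. (exp (k / s * x), s + h x)" "b / 2"])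
    fix x assume x: "x \<in> {..<0}" "(zb x, ub x) = (exp (k / s * x), s + h x)"
    have "isCont ub x" using c(1) x(1) by (simp add: continuous_on_eq_continuous_at)
    then have t: "(ub \<longlongrightarrow> ub x) (nhds x)"
      by (simp add: isCont_def tendsto_at_iff_tendsto_nhds)
    \<comment> \<open>Agreement with the candidate at one point puts \<open>u\<close> into the open
      set \<open>M\<close> above \<open>s\<close>, hence a whole neighbourhood of the point burns
      with \<open>\<phi> = 1\<close> and lies on the upper root branch.\<close>
    have "ub x \<in> M" "ub x > s" using h[of x] x M(2) by auto
    then have "\<forall>\<^sub>F y in nhds x. ub y \<in> M \<and> ub y > s \<and> y \<in> {..<0}"
      using topological_tendstoD[OF t M(1)] order_tendstoD(1)[OF t] x(1)
      by (intro eventually_conj eventually_nhds_in_open) auto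
    then obtain e where e: "e > 0" "\<And>y. y \<in> ball x e \<Longrightarrow> ub y \<in> M \<and> ub y > s \<and> y < 0"
      by (auto simp: eventually_nhds_metric dist_commute)
    then obtain C where C: "\<And>y. y \<in> ball x e \<Longrightarrow> zb y = C * exp (k / s * y)"
      using z[of "ball x e"] by fastforce
    have "C = 1" using C[of x] e x(2) by simp
    have "\<forall>\<^sub>F y in nhds x. y \<in> ball x e" using e by (intro eventually_nhds_in_open) auto
    then show "\<forall>\<^sub>F y in nhds x. (zb y, ub y) = (exp (k / s * y), s + h y)"
    proof eventually_elim
      case (elim y)
      then show ?case using C[of y] e(2)[of y] u[of y] \<open>C = 1\<close> by simp
    qed
  qed (use c start s \<open>\<xi> < 0\<close> in \<open>auto intro!: continuous_intros simp: h_def\<close>)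
  then show "zb \<xi> = exp (k / s * \<xi>)"
    and "ub \<xi> = s + sqrt ((s - up)\<^sup>2 - 2 * q * s * (1 - exp (k / s * \<xi>)))"
    by (simp_all add: h_def)
  then show "ub \<xi> > s" "ub \<xi> \<in> M"
    using h[OF \<open>\<xi> < 0\<close>] M(2) by (auto simp: h_def)
  show "(ub \<longlongrightarrow> 2 * s - up) (at_left 0)"
    using ul ul_eq by simp
qed

section \<open>The eigenvalue equation and the Lopatinski determinant\<close>

text \<open>\<open>matrix_inv\<close> is defined by choice, so an explicit inverse has to be
  identified with the chosen one.\<close>

lemma matrix_inv_unique:
  fixes A B :: "'a::semiring_1^'n^'n"
  assumes "A ** B = mat 1" "B ** A = mat 1"
  shows "matrix_inv A = B"
proof -
  have "A ** matrix_inv A = mat 1 \<and> matrix_inv A ** A = mat 1"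
    unfolding matrix_inv_def by (rule someI[of _ B]) (use assms in simp)
  then have "matrix_inv A = (B ** A) ** matrix_inv A" "B ** (A ** matrix_inv A) = B"
    using assms by (simp_all add: matrix_mul_lid matrix_mul_rid)
  then show ?thesis by (simp add: matrix_mul_assoc)
qed

lemma vector_2_eq_iff: "x = y \<longleftrightarrow> x $ 1 = y $ 1 \<and> x $ 2 = y $ 2" for x y :: "'a^2"
  by (simp add: vec_eq_iff forall_2)

lemma matrix_inv_diagonal_2:
  fixes a b :: "'a::field"
  assumes "a \<noteq> 0" "b \<noteq> 0"
  shows "matrix_inv (vector [vector [a, 0], vector [0, b]] :: 'a^2^2) = vector [vector [1 / a, 0], vector [0, 1 / b]]"
  using assms
  by (intro matrix_inv_unique) (simp_all add: vector_2_eq_iff matrix_matrix_mult_def sum_2 mat_def)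

text \<open>In the fully ignited region the first column of \<open>E\<close> vanishes and the system
  is upper triangular: the reactant component evolves by itself and forces the other one.\<close>

lemma G_mat_reaction_zone:
  assumes "\<phi> (ub \<xi>) = 1" "deriv \<phi> (ub \<xi>) = 0" "ub \<xi> \<noteq> s" "s \<noteq> 0"
  shows "(G_mat q k \<phi> s ub zb \<mu> \<xi> *v v) $ 1 = - \<mu> / of_real (ub \<xi> - s) * v $ 1 - of_real (q * k / s) * v $ 2"
    and "(G_mat q k \<phi> s ub zb \<mu> \<xi> *v v) $ 2 = (of_real k + \<mu>) / of_real s * v $ 2"
proof -
  define a where "a = complex_of_real (ub \<xi> - s)"
  have "a \<noteq> 0" using assms(3) by (simp add: a_def del: of_real_diff)
  then have "matrix_inv (A_mat s ub \<xi>) = vector [vector [1 / a, 0], vector [0, 1 / - of_real s]]"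
    unfolding A_mat_def a_def[symmetric] using assms(4) by (intro matrix_inv_diagonal_2) simp_all
  then show "(G_mat q k \<phi> s ub zb \<mu> \<xi> *v v) $ 1 = - \<mu> / of_real (ub \<xi> - s) * v $ 1 - of_real (q * k / s) * v $ 2"
    and "(G_mat q k \<phi> s ub zb \<mu> \<xi> *v v) $ 2 = (of_real k + \<mu>) / of_real s * v $ 2"
    unfolding G_mat_def E_mat_def a_def[symmetric]
    by (simp_all add: assms(1,2) matrix_matrix_mult_def matrix_vector_mult_def sum_2 mat_def
        add_divide_distrib diff_divide_distrib)
qed

text \<open>The sum \<open>V = Z1 + q Z2\<close> satisfies \<open>V' = - \<mu> V / h + \<mu> q Z2 (1 / h + 1 / s)\<close>, whose forcing is at most
  \<open>norm \<mu> / k\<close> times the derivative of \<open>h + q exp (k x / s)\<close>; the damping factor only helps when \<open>Re \<mu> \<ge> 0\<close>.\<close>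

lemma decaying_solution_bound:
  fixes Z1 Z2 :: "real \<Rightarrow> complex" and h :: "real \<Rightarrow> real"
  assumes pos: "q > 0" "k > 0" "s > 0" and \<mu>: "Re \<mu> \<ge> 0"
    and h: "\<And>x. x < 0 \<Longrightarrow> h x > 0"
      "\<And>x. x < 0 \<Longrightarrow> (h has_real_derivative q * k * exp (k / s * x) / h x) (at x)"
      "(h \<longlongrightarrow> h0) at_bot" "(h \<longlongrightarrow> h1) (at_left 0)"
    and Z1: "\<And>x. x < 0 \<Longrightarrow> (Z1 has_vector_derivative
        - \<mu> / of_real (h x) * Z1 x - of_real (q * k / s) * Z2 x) (at x)"
      "(Z1 \<longlongrightarrow> Z1 0) (at_left 0)" "(Z1 \<longlongrightarrow> 0) at_bot"
    and Z2: "\<And>x. x < 0 \<Longrightarrow> (Z2 has_vector_derivative (of_real k + \<mu>) / of_real s * Z2 x) (at x)"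
      "(Z2 \<longlongrightarrow> Z2 0) (at_left 0)" "(Z2 \<longlongrightarrow> 0) at_bot"
  shows "norm (Z1 0 + of_real q * Z2 0) \<le> norm \<mu> * norm (Z2 0) / k * (h1 - h0 + q)"
    and "Z2 0 = 0 \<Longrightarrow> x < 0 \<Longrightarrow> Z1 x = 0 \<and> Z2 x = 0"
proof -
  define m where "m = (of_real k + \<mu>) / of_real s"
  define c where "c = Z2 0"
  have dexp: "((\<lambda>x. exp (of_real x * w)) has_vector_derivative w * exp (of_real x * w)) (at x)" for w :: complex and x
    using exp_scaleR_has_vector_derivative_right[of w x UNIV]
    by (simp add: scaleR_conv_of_real mult.commute)
  have Z2eq: "Z2 x = c * exp (of_real x * m)" if "x < 0" for x
  proof -
    have "((\<lambda>x. Z2 x * exp (of_real x * - m)) has_vector_derivative 0) (at x within {..<0})" if "x \<in> {..<0}" for x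
    proof -
      have "((\<lambda>x. Z2 x * exp (of_real x * - m)) has_vector_derivative
          Z2 x * (- m * exp (of_real x * - m)) + (m * Z2 x) * exp (of_real x * - m)) (at x)"
        using Z2(1)[of x] that unfolding m_def[symmetric] by (intro has_vector_derivative_mult dexp) auto
      then show ?thesis by (auto intro: has_vector_derivative_at_within simp: algebra_simps)
    qed
    from has_vector_derivative_zero_constant[OF _ this]
    obtain C where C: "\<And>x. x < 0 \<Longrightarrow> Z2 x * exp (of_real x * - m) = C" by auto
    have "((\<lambda>x. Z2 x * exp (of_real x * - m)) \<longlongrightarrow> Z2 0 * exp (of_real 0 * - m)) (at_left 0)"
      by (intro tendsto_intros Z2(2))
    moreover have "((\<lambda>x. Z2 x * exp (of_real x * - m)) \<longlongrightarrow> C) (at_left 0)"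
      using C by (auto intro!: tendsto_eventually simp: eventually_at_filter)
    ultimately have "C = c"
      using tendsto_unique[OF trivial_limit_at_left_real] by (fastforce simp: c_def)
    have "Z2 x = Z2 x * exp (of_real x * - m) * exp (of_real x * m)"
      by (simp add: exp_minus)
    also have "\<dots> = c * exp (of_real x * m)" using C[OF that] \<open>C = c\<close> by simp
    finally show ?thesis .
  qed
  define V where "V = (\<lambda>x. Z1 x + of_real q * Z2 x)"
  define P where "P = (\<lambda>x. h x + q * exp (k / s * x))"
  have V0: "(V \<longlongrightarrow> V 0) (at_left 0)" "(V \<longlongrightarrow> 0) at_bot"
    unfolding V_def using Z1 Z2 by (auto intro!: tendsto_eq_intros)
  have P0: "(P \<longlongrightarrow> h1 + q) (at_left 0)" "(P \<longlongrightarrow> h0) at_bot"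
  proof -
    have "(P \<longlongrightarrow> h1 + q * exp (k / s * 0)) (at_left 0)"
      unfolding P_def by (intro tendsto_intros h)
    then show "(P \<longlongrightarrow> h1 + q) (at_left 0)" by simp
    have "filterlim (\<lambda>x. k / s * x) at_bot at_bot"
      using pos by (intro filterlim_tendsto_pos_mult_at_bot[OF tendsto_const _ filterlim_ident]) auto
    from filterlim_compose[OF exp_at_bot this]
    have "((\<lambda>x. exp (k / s * x)) \<longlongrightarrow> 0) at_bot" .
    from tendsto_add[OF h(3) tendsto_mult_left[OF this, of q]]
    show "(P \<longlongrightarrow> h0) at_bot" by (simp add: P_def)
  qed
  have dP: "(P has_real_derivative q * k * exp (k / s * x) * (1 / h x + 1 / s)) (at x)" if "x < 0" for x
    unfolding P_def using h(2)[OF that] pos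
    by (auto intro!: derivative_eq_intros simp: distrib_left)
  have dV: "(V has_vector_derivative - \<mu> / of_real (h x) * V x
      + \<mu> * of_real q * Z2 x * of_real (1 / h x + 1 / s)) (at x)" if "x < 0" for x
  proof -
    have "(V has_vector_derivative (- \<mu> / of_real (h x) * Z1 x - of_real (q * k / s) * Z2 x) +
        of_real q * ((of_real k + \<mu>) / of_real s * Z2 x)) (at x)"
      unfolding V_def by (intro has_vector_derivative_add has_vector_derivative_mult_right Z1 Z2 that)
    also have "(- \<mu> / of_real (h x) * Z1 x - of_real (q * k / s) * Z2 x) +
        of_real q * ((of_real k + \<mu>) / of_real s * Z2 x) =
        - \<mu> / of_real (h x) * V x + \<mu> * of_real q * Z2 x * of_real (1 / h x + 1 / s)"
      using h(1)[OF that] pos by (simp add: V_def field_simps)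
    finally show ?thesis .
  qed
  \<comment> \<open>Variation of constants on a compact interval; letting \<open>x\<close> tend to
    \<open>-\<infinity>\<close> only afterwards avoids normalising the antiderivative
    \<open>H\<close> of \<open>1 / h\<close> on the unbounded half-line.\<close>
  have step: "norm (V y) \<le> norm (V x) + norm \<mu> * norm c / k * (P y - P x)" if "x < y" "y < 0" for x y
  proof -
    have "continuous_on {x..y} h"
      using that by (intro continuous_at_imp_continuous_on) (auto intro!: DERIV_isCont[OF h(2)])
    then have "continuous_on {x..y} (\<lambda>t. 1 / h t)"
      using that h(1) by (intro continuous_intros) (auto simp: less_imp_neq[symmetric])
    then obtain H where H: "\<And>t. t \<in> {x..y} \<Longrightarrow> (H has_vector_derivative 1 / h t) (at t within {x..y})"
      by (rule antiderivative_continuous) blast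
    have cH: "continuous_on {x..y} H"
      unfolding continuous_on_eq_continuous_within by (intro ballI has_vector_derivative_continuous[OF H])
    have dH: "(H has_real_derivative 1 / h t) (at t)" if "t \<in> {x<..<y}" for t
      using H[of t] that by (simp add: at_within_Icc_at has_real_derivative_iff_has_vector_derivative)
    have mono: "H t \<le> H y" if "t \<in> {x..y}" for t
    proof (rule DERIV_nonneg_imp_increasing_open[of t y H])
      fix u assume "t < u" "u < y"
      then show "\<exists>d. (H has_real_derivative d) (at u) \<and> 0 \<le> d"
        using dH[of u] h(1)[of u] that \<open>y < 0\<close> by (intro exI[of _ "1 / h u"]) auto
    qed (use that in \<open>auto intro: continuous_on_subset[OF cH]\<close>)
    define W where "W = (\<lambda>t. V t * exp (of_real (H t) * \<mu>))"
    \<comment> \<open>\<open>H\<close> increases and \<open>Re \<mu> \<ge> 0\<close>, so the modulus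
      of the integrating factor is largest at \<open>y\<close>. This maximum \<open>e\<close> bounds
      it throughout and cancels at the end.\<close>
    define e where "e = exp (H y * Re \<mu>)"
    have e: "norm (exp (of_real (H t) * \<mu>)) \<le> e" if "t \<in> {x..y}" for t
      using mono[OF that] \<mu> by (simp add: e_def mult_right_mono)
    have ey: "norm (exp (of_real (H y) * \<mu>)) = e" "e > 0"
      by (simp_all add: e_def)
    have cV: "continuous_on {x..y} V"
      using \<open>y < 0\<close> by (intro continuous_at_imp_continuous_on)
        (auto intro!: has_vector_derivative_continuous[OF dV])
    have "norm (W y - W x) \<le> norm \<mu> * norm c / k * e * P y - norm \<mu> * norm c / k * e * P x"
    proof (rule differentiable_bound_general[OF \<open>x < y\<close>, of W "\<lambda>t. norm \<mu> * norm c / k * e * P t"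
          "\<lambda>t. \<mu> * of_real q * Z2 t * of_real (1 / h t + 1 / s) * exp (of_real (H t) * \<mu>)"
          "\<lambda>t. norm \<mu> * norm c / k * e * (q * k * exp (k / s * t) * (1 / h t + 1 / s))"])
      show "continuous_on {x..y} W"
        unfolding W_def by (intro continuous_intros cV cH)
      show "continuous_on {x..y} (\<lambda>t. norm \<mu> * norm c / k * e * P t)"
        using \<open>y < 0\<close> by (intro continuous_intros continuous_at_imp_continuous_on)
          (auto intro!: DERIV_isCont[OF dP])
      fix t assume t: "x < t" "t < y"
      then have t0: "t < 0" "t \<in> {x..y}" using \<open>y < 0\<close> by auto
      have dE: "((\<lambda>t. exp (of_real (H t) * \<mu>)) has_vector_derivative
          (1 / h t) *\<^sub>R (\<mu> * exp (of_real (H t) * \<mu>))) (at t)"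
        using vector_diff_chain_at[OF dH[of t, unfolded has_real_derivative_iff_has_vector_derivative] dexp] t
        by (simp add: o_def)
      have "(W has_vector_derivative V t * ((1 / h t) *\<^sub>R (\<mu> * exp (of_real (H t) * \<mu>))) +
          (- \<mu> / of_real (h t) * V t + \<mu> * of_real q * Z2 t * of_real (1 / h t + 1 / s))
            * exp (of_real (H t) * \<mu>)) (at t)"
        unfolding W_def by (intro has_vector_derivative_mult dE dV t0)
      also have "V t * ((1 / h t) *\<^sub>R (\<mu> * exp (of_real (H t) * \<mu>))) +
          (- \<mu> / of_real (h t) * V t + \<mu> * of_real q * Z2 t * of_real (1 / h t + 1 / s))
            * exp (of_real (H t) * \<mu>) =
          \<mu> * of_real q * Z2 t * of_real (1 / h t + 1 / s) * exp (of_real (H t) * \<mu>)"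
        by (simp add: scaleR_conv_of_real algebra_simps)
      finally show "(W has_vector_derivative
          \<mu> * of_real q * Z2 t * of_real (1 / h t + 1 / s) * exp (of_real (H t) * \<mu>)) (at t)" .
      show "((\<lambda>t. norm \<mu> * norm c / k * e * P t) has_vector_derivative
          norm \<mu> * norm c / k * e * (q * k * exp (k / s * t) * (1 / h t + 1 / s))) (at t)"
        unfolding has_real_derivative_iff_has_vector_derivative[symmetric]
        by (intro DERIV_cmult dP t0)
      have hs: "1 / h t + 1 / s \<ge> 0" using h(1)[OF t0(1)] pos by simp
      \<comment> \<open>On the negative half-line the part of the exponent of \<open>Z2\<close>
        coming from \<open>\<mu>\<close> can only reduce the modulus, so
        \<open>exp (k / s * t)\<close> dominates uniformly in \<open>\<mu>\<close>.\<close>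
      have "t * Re \<mu> / s \<le> 0"
        using t0 \<mu> pos by (intro divide_nonpos_pos mult_nonpos_nonneg) auto
      then have "norm (Z2 t) \<le> norm c * exp (k / s * t)"
        using t0 pos by (simp add: Z2eq norm_mult m_def Re_divide_of_real distrib_left add_divide_distrib mult_left_mono mult.commute)
      then have "norm \<mu> * q * norm (Z2 t) * (1 / h t + 1 / s) * norm (exp (of_real (H t) * \<mu>))
          \<le> norm \<mu> * q * (norm c * exp (k / s * t)) * (1 / h t + 1 / s) * e"
        using pos hs e[OF t0(2)] ey by (intro mult_mono mult_nonneg_nonneg) auto
      also have "\<dots> = norm \<mu> * norm c / k * e * (q * k * exp (k / s * t) * (1 / h t + 1 / s))"
        using pos by simp
      finally show "norm (\<mu> * of_real q * Z2 t * of_real (1 / h t + 1 / s) * exp (of_real (H t) * \<mu>))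
          \<le> norm \<mu> * norm c / k * e * (q * k * exp (k / s * t) * (1 / h t + 1 / s))"
        using pos hs by (simp only: norm_mult norm_of_real abs_of_nonneg abs_of_pos)
    qed
    moreover have "norm (W y) = norm (V y) * e" by (simp only: W_def norm_mult ey)
    moreover have "norm (W x) \<le> norm (V x) * e"
      using e[of x] \<open>x < y\<close> by (simp add: W_def norm_mult mult_left_mono)
    moreover have "norm (W y) \<le> norm (W x) + norm (W y - W x)"
      by (metis norm_triangle_sub)
    ultimately have "norm (V y) * e \<le> (norm (V x) + norm \<mu> * norm c / k * (P y - P x)) * e"
      by (simp add: algebra_simps diff_divide_distrib)
    then show ?thesis using ey(2) by simp
  qed
  \<comment> \<open>Decay removes the term \<open>norm (V x)\<close> as \<open>x\<close> tends to
    \<open>-\<infinity>\<close>, and \<open>P x\<close> tends to \<open>h0\<close> because its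
    exponential part vanishes.\<close>
  have bound: "norm (V y) \<le> norm \<mu> * norm c / k * (P y - h0)" if "y < 0" for y
  proof -
    have "((\<lambda>x. norm (V x) + norm \<mu> * norm c / k * (P y - P x)) \<longlongrightarrow> norm (0::complex) + norm \<mu> * norm c / k * (P y - h0)) at_bot"
      by (intro tendsto_intros V0 P0)
    moreover have "\<forall>\<^sub>F x in at_bot. norm (V y) \<le> norm (V x) + norm \<mu> * norm c / k * (P y - P x)"
      using eventually_gt_at_bot[of y] by eventually_elim (use step that in auto)
    ultimately show ?thesis
      using tendsto_lowerbound[of _ _ at_bot "norm (V y)"] by fastforce
  qed
  have "((\<lambda>y. norm \<mu> * norm c / k * (P y - h0)) \<longlongrightarrow> norm \<mu> * norm c / k * (h1 + q - h0)) (at_left 0)"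
    by (intro tendsto_intros P0)
  moreover have "\<forall>\<^sub>F y in at_left 0. norm (V y) \<le> norm \<mu> * norm c / k * (P y - h0)"
    using bound by (auto simp: eventually_at_filter)
  ultimately have "norm (V 0) \<le> norm \<mu> * norm c / k * (h1 + q - h0)"
    using tendsto_le[OF trivial_limit_at_left_real _ tendsto_norm[OF V0(1)]] by blast
  then show "norm (Z1 0 + of_real q * Z2 0) \<le> norm \<mu> * norm (Z2 0) / k * (h1 - h0 + q)"
    by (simp add: V_def c_def algebra_simps)
  \<comment> \<open>The bound is proportional to \<open>norm (Z2 0)\<close>, so a decaying solution
    is determined by that one number; this later shows that it is nonzero for a nontrivial
    mode.\<close>
  show "Z1 x = 0 \<and> Z2 x = 0" if "Z2 0 = 0" "x < 0"
    using bound[OF that(2)] Z2eq[OF that(2)] that(1) by (simp add: c_def V_def)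
qed

lemma decays_exponentially_tendsto_0:
  assumes "decays_exponentially Y"
  shows "(Y \<longlongrightarrow> 0) at_bot"
proof -
  obtain C \<eta> where \<eta>: "\<eta> > 0" and C: "\<forall>\<^sub>F \<xi> in at_bot. norm (Y \<xi>) \<le> C * exp (\<eta> * \<xi>)"
    using assms by (auto simp: decays_exponentially_def)
  have "filterlim (\<lambda>x. \<eta> * x) at_bot at_bot"
    using \<eta> by (intro filterlim_tendsto_pos_mult_at_bot[OF tendsto_const _ filterlim_ident])
  from tendsto_mult_left[OF filterlim_compose[OF exp_at_bot this], of C]
  have "((\<lambda>x. C * exp (\<eta> * x)) \<longlongrightarrow> 0) at_bot" by simp
  with C show ?thesis by (rule Lim_null_comparison)
qed

section \<open>Jumps, the explicit determinant and its zeros\<close>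

text \<open>Written with constant axis vectors, the profile inherits limits and derivatives from its
  scalar components through bounded linear maps.\<close>

lemma vector_2_eq_axis: "(vector [of_real a, of_real b] :: complex^2) = a *\<^sub>R axis 1 (1::complex) + b *\<^sub>R axis 2 1"
  by (simp add: vector_2_eq_iff axis_def scaleR_conv_of_real[where 'a=complex])

lemma jump_eq:
  assumes "(h \<longlongrightarrow> r) (at_right 0)" "(h \<longlongrightarrow> l) (at_left 0)"
  shows "jump h = r - l"
  using assms by (simp add: jump_def tendsto_Lim)

lemma D_ZND_eq:
  "D_ZND s ub zb Z \<mu> =
    Z \<mu> 0 $ 1 * (\<mu> * jump (profile ub zb) $ 2 - jump (\<lambda>\<xi>. A_mat s ub \<xi> *v vector_derivative (profile ub zb) (at \<xi>)) $ 2)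
    - Z \<mu> 0 $ 2 * (\<mu> * jump (profile ub zb) $ 1 - jump (\<lambda>\<xi>. A_mat s ub \<xi> *v vector_derivative (profile ub zb) (at \<xi>)) $ 1)"
  by (simp add: D_ZND_def det_2 transpose_def mult.commute)

lemma zorder_eq_1I:
  assumes "f analytic_on {z}" "f z = 0" "deriv f z \<noteq> 0"
  shows "zorder f z = 1"
  using zorder_zero_eqI'[of f z 1] assms by simp

text \<open>Both kinds of ignition function reduce to this form, in which \<open>\<phi>\<close> is
  known only on an open set around the unburnt state and on one around the range of the reaction
  zone.\<close>

lemma D_ZND_zeros_of_locally_constant_ignition:
  fixes q k s up :: real
    and \<phi> ub zb :: "real \<Rightarrow> real"
    and Z :: "complex \<Rightarrow> real \<Rightarrow> complex^2"
  assumes "q > 0" "k > 0" and CJ: "2 * q * s < (s - up)\<^sup>2"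
    and N: "open N" "up \<in> N" "\<And>u. u \<in> N \<Longrightarrow> \<phi> u = 0"
    and M: "open M" "{u_minus q s up..u_star s up} \<subseteq> M" "\<And>u. u \<in> M \<Longrightarrow> \<phi> u = 1"
    and wave: "strong_znd_detonation q k \<phi> s um up ub zb"
    and mode: "decaying_mode q k \<phi> s ub zb Z"
  shows "{\<mu>. Re \<mu> \<ge> 0 \<and> D_ZND s ub zb Z \<mu> = 0} = {0} \<and> zorder (D_ZND s ub zb Z) 0 = 1"
proof -
  have s: "up \<ge> 0" "s > up" "s > 0" using wave by (auto simp: strong_znd_detonation_def)
  define h where "h = (\<lambda>x. sqrt ((s - up)\<^sup>2 - 2 * q * s * (1 - exp (k / s * x))))"
  define h0 h1 where "h0 = sqrt ((s - up)\<^sup>2 - 2 * q * s)" and "h1 = s - up"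
  have right: "ub x = up \<and> zb x = 1" if "x > 0" for x
    using strong_znd_detonation_quiescent[OF wave N that] .
  note zone = strong_znd_detonation_reaction_zone[OF wave assms(1,2) CJ N(1,2) _ M(1,2)]
  have zb: "zb x = exp (k / s * x)" and ub: "ub x = s + h x" and hpos: "h x > 0" and ubM: "ub x \<in> M" if "x < 0" for x
    using zone(1-4)[OF N(3) M(3) that] by (simp_all add: h_def)
  have dh: "(h has_real_derivative q * k * exp (k / s * x) / h x) (at x)" if "x < 0" for x
  proof -
    have "(s - up)\<^sup>2 - 2 * q * s * (1 - exp (k / s * x)) > 0"
      using hpos[OF that] by (simp add: h_def)
    then show ?thesis
      unfolding h_def using s(3)
      by (auto intro!: derivative_eq_intros simp: field_simps)
  qed
  have ek: "((\<lambda>x. exp (k / s * x)) \<longlongrightarrow> exp (k / s * 0)) (at_left 0)"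
    by (intro tendsto_intros)
  have h1: "(h \<longlongrightarrow> h1) (at_left 0)"
  proof -
    have "(h \<longlongrightarrow> sqrt ((s - up)\<^sup>2 - 2 * q * s * (1 - exp (k / s * 0)))) (at_left 0)"
      unfolding h_def by (intro tendsto_intros ek)
    then show ?thesis using s by (simp add: h1_def)
  qed
  have h0: "(h \<longlongrightarrow> h0) at_bot"
  proof -
    have "filterlim (\<lambda>x. k / s * x) at_bot at_bot"
      using assms s by (intro filterlim_tendsto_pos_mult_at_bot[OF tendsto_const _ filterlim_ident]) auto
    from filterlim_compose[OF exp_at_bot this]
    have "(h \<longlongrightarrow> sqrt ((s - up)\<^sup>2 - 2 * q * s * (1 - 0))) at_bot"
      unfolding h_def by (intro tendsto_intros)
    then show ?thesis by (simp add: h0_def)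
  qed
  have "h1 > 0" using s by (simp add: h1_def)
  have K: "h1 - h0 + q < 2 * h1"
  proof -
    have h0p: "h0 > 0" using CJ by (simp add: h0_def)
    have "h0\<^sup>2 = h1\<^sup>2 - 2 * q * s" using CJ by (simp add: h0_def h1_def)
    \<comment> \<open>Factoring \<open>h1\<^sup>2 - h0\<^sup>2\<close> leaves \<open>h1 - h0\<close>
      to compare with \<open>2 * s\<close>; since \<open>up \<ge> 0\<close>, already
      \<open>h1 \<le> s\<close>, so the inequality is strict with room to spare.\<close>
    then have "q * (2 * s) = (h1 - h0) * (h1 + h0)" by (simp add: power2_eq_square algebra_simps)
    also have "\<dots> < (2 * s) * (h1 + h0)"
      using h0p s by (intro mult_strict_right_mono) (auto simp: h1_def)
    finally have "q * (2 * s) < (h1 + h0) * (2 * s)" by (simp add: mult.commute)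
    then have "q < h1 + h0" using s by simp
    then show ?thesis by simp
  qed

  have profile_axis: "profile ub zb = (\<lambda>x. ub x *\<^sub>R axis 1 1 + zb x *\<^sub>R axis 2 1)"
    by (simp add: profile_def vector_2_eq_axis fun_eq_iff)
  have zl: "(zb \<longlongrightarrow> 1) (at_left 0)"
  proof (rule Lim_transform_eventually)
    show "\<forall>\<^sub>F x in at_left 0. exp (k / s * x) = zb x"
      using zb by (auto simp: eventually_at_filter)
  qed (use ek in simp)
  have ur: "(ub \<longlongrightarrow> up) (at_right 0)" "(zb \<longlongrightarrow> 1) (at_right 0)"
    using right by (auto intro!: tendsto_eventually simp: eventually_at_filter)
  have "jump (profile ub zb) = (up *\<^sub>R axis 1 1 + 1 *\<^sub>R axis 2 1) - ((2 * s - up) *\<^sub>R axis 1 1 + 1 *\<^sub>R axis 2 1)"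
    unfolding profile_axis by (intro jump_eq tendsto_intros ur zl zone(5)[OF N(3) M(3), of "-1"]) simp_all
  then have jW: "jump (profile ub zb) $ 1 = - 2 * of_real h1" "jump (profile ub zb) $ 2 = 0"
    by (simp_all add: axis_def h1_def scaleR_conv_of_real[where 'a=complex])
  have "vector_derivative (profile ub zb) (at x) = 0" if "x > 0" for x
  proof -
    have "\<forall>\<^sub>F y in nhds x. y \<in> {0<..}" using that by (intro eventually_nhds_in_open) auto
    then have "\<forall>\<^sub>F y in nhds x. profile ub zb y = vector [of_real up, of_real 1]"
      by eventually_elim (use right in \<open>simp add: profile_def\<close>)
    then have "vector_derivative (profile ub zb) (at x) =
        vector_derivative (\<lambda>_. vector [of_real up, of_real 1] :: complex^2) (at x)"
      by (intro vector_derivative_cong_eq) simp_all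
    then show ?thesis by simp
  qed
  then have r0: "((\<lambda>x. A_mat s ub x *v vector_derivative (profile ub zb) (at x)) \<longlongrightarrow> 0) (at_right 0)"
    by (auto intro!: tendsto_eventually simp: eventually_at_filter)
  \<comment> \<open>Multiplication by \<open>A\<close> cancels the denominators \<open>h\<close> and
    \<open>s\<close> of the two derivatives, leaving the reaction source
    \<open>(q k z, - k z)\<close> with \<open>z\<close> the exponential.\<close>
  have vd: "A_mat s ub x *v vector_derivative (profile ub zb) (at x)
      = (exp (k / s * x)) *\<^sub>R vector [of_real (q * k), of_real (- k)]" if "x < 0" for x
  proof -
    have ev: "\<forall>\<^sub>F y in nhds x. y \<in> {..<0}" using that by (intro eventually_nhds_in_open) auto
    have "(ub has_real_derivative q * k * exp (k / s * x) / h x) (at x)"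
    proof -
      have "\<forall>\<^sub>F y in nhds x. ub y = s + h y" using ev by eventually_elim (use ub in simp)
      moreover have "((\<lambda>y. s + h y) has_real_derivative q * k * exp (k / s * x) / h x) (at x)"
        using dh[OF that] by (auto intro!: derivative_eq_intros)
      ultimately show ?thesis by (simp only: DERIV_cong_ev[OF refl _ refl])
    qed
    moreover have "(zb has_real_derivative exp (k / s * x) * (k / s)) (at x)"
    proof -
      have "\<forall>\<^sub>F y in nhds x. zb y = exp (k / s * y)" using ev by eventually_elim (use zb in simp)
      moreover have "((\<lambda>y. exp (k / s * y)) has_real_derivative exp (k / s * x) * (k / s)) (at x)"
        by (intro DERIV_chain2[OF DERIV_exp DERIV_cmult_Id])
      ultimately show ?thesis by (simp only: DERIV_cong_ev[OF refl _ refl])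
    qed
    ultimately have "(profile ub zb has_vector_derivative
        (q * k * exp (k / s * x) / h x) *\<^sub>R axis 1 1 + (exp (k / s * x) * (k / s)) *\<^sub>R axis 2 1) (at x)"
      unfolding profile_axis has_real_derivative_iff_has_vector_derivative
      by (intro has_vector_derivative_add bounded_linear.has_vector_derivative[OF bounded_linear_scaleR_left])
    then have "vector_derivative (profile ub zb) (at x) =
        (q * k * exp (k / s * x) / h x) *\<^sub>R axis 1 1 + (exp (k / s * x) * (k / s)) *\<^sub>R axis 2 1"
      by (rule vector_derivative_at)
    then show ?thesis
      using hpos[OF that] s ub[OF that]
      by (simp add: vector_2_eq_iff A_mat_def matrix_vector_mult_def sum_2 axis_def scaleR_conv_of_real[where 'a=complex])
  qed
  have "((\<lambda>x. (exp (k / s * x)) *\<^sub>R vector [of_real (q * k), of_real (- k)] :: complex^2) \<longlongrightarrow>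
      exp (k / s * 0) *\<^sub>R vector [of_real (q * k), of_real (- k)]) (at_left 0)"
    by (intro tendsto_intros ek)
  then have l0: "((\<lambda>x. A_mat s ub x *v vector_derivative (profile ub zb) (at x)) \<longlongrightarrow>
      exp (k / s * 0) *\<^sub>R vector [of_real (q * k), of_real (- k)]) (at_left 0)"
    by (rule Lim_transform_eventually) (use vd in \<open>auto simp: eventually_at_filter\<close>)
  have jA: "jump (\<lambda>x. A_mat s ub x *v vector_derivative (profile ub zb) (at x)) $ 1 = - of_real (q * k)"
    "jump (\<lambda>x. A_mat s ub x *v vector_derivative (profile ub zb) (at x)) $ 2 = of_real k"
    using jump_eq[OF r0 l0] by simp_all

  define V where "V = (\<lambda>\<mu>. Z \<mu> 0 $ 1 + of_real q * Z \<mu> 0 $ 2)"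
  \<comment> \<open>The jump of \<open>z\<close> is zero and that of \<open>u\<close> is
    \<open>- 2 h1\<close>; the source vanishes on the right, so its jump is minus the left limit.
    The two source entries then combine \<open>Z1\<close> and \<open>Z2\<close> into exactly
    \<open>V\<close>.\<close>
  have D: "D_ZND s ub zb Z = (\<lambda>\<mu>. 2 * of_real h1 * \<mu> * Z \<mu> 0 $ 2 - of_real k * V \<mu>)"
    unfolding D_ZND_eq jW jA by (simp add: fun_eq_iff V_def algebra_simps)
  have main: "norm (V \<mu>) \<le> norm \<mu> * norm (Z \<mu> 0 $ 2) / k * (h1 - h0 + q) \<and> Z \<mu> 0 $ 2 \<noteq> 0"
    if \<mu>: "Re \<mu> \<ge> 0" for \<mu>
  proof -
    have m: "\<And>x. x < 0 \<Longrightarrow> (Z \<mu> has_vector_derivative G_mat q k \<phi> s ub zb \<mu> x *v Z \<mu> x) (at x)"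
      "(Z \<mu> \<longlongrightarrow> Z \<mu> 0) (at_left 0)" "\<exists>x<0. Z \<mu> x \<noteq> 0" "decays_exponentially (Z \<mu>)"
      using mode \<mu> unfolding decaying_mode_def by blast+
    have G: "(G_mat q k \<phi> s ub zb \<mu> x *v v) $ 1 = - \<mu> / of_real (h x) * v $ 1 - of_real (q * k / s) * v $ 2"
      "(G_mat q k \<phi> s ub zb \<mu> x *v v) $ 2 = (of_real k + \<mu>) / of_real s * v $ 2" if "x < 0" for x v
    proof -
      have "\<forall>\<^sub>F u in nhds (ub x). u \<in> M" using M(1) ubM[OF that] by (rule eventually_nhds_in_open)
      then have "\<forall>\<^sub>F u in nhds (ub x). \<phi> u = 1" by eventually_elim (rule M(3))
      then have "deriv \<phi> (ub x) = deriv (\<lambda>_. 1) (ub x)" by (rule deriv_cong_ev) simp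
      then have d: "deriv \<phi> (ub x) = 0" by simp
      have "ub x \<noteq> s" "s \<noteq> 0" using ub[OF that] hpos[OF that] s by auto
      from G_mat_reaction_zone[of \<phi> ub x s, OF M(3)[OF ubM[OF that]] d this]
      show "(G_mat q k \<phi> s ub zb \<mu> x *v v) $ 1 = - \<mu> / of_real (h x) * v $ 1 - of_real (q * k / s) * v $ 2"
        "(G_mat q k \<phi> s ub zb \<mu> x *v v) $ 2 = (of_real k + \<mu>) / of_real s * v $ 2"
        using ub[OF that] by simp_all
    qed
    have dZ: "((\<lambda>x. Z \<mu> x $ i) has_vector_derivative (G_mat q k \<phi> s ub zb \<mu> x *v Z \<mu> x) $ i) (at x)" if "x < 0" for x i
      by (rule bounded_linear.has_vector_derivative[OF bounded_linear_vec_nth m(1)[OF that]])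
    have lim: "((\<lambda>x. Z \<mu> x $ i) \<longlongrightarrow> Z \<mu> 0 $ i) (at_left 0)" "((\<lambda>x. Z \<mu> x $ i) \<longlongrightarrow> 0) at_bot" for i
      using tendsto_vec_nth[OF m(2), of i] tendsto_vec_nth[OF decays_exponentially_tendsto_0[OF m(4)], of i] by simp_all
    have dZ1: "((\<lambda>x. Z \<mu> x $ 1) has_vector_derivative
        - \<mu> / of_real (h x) * Z \<mu> x $ 1 - of_real (q * k / s) * Z \<mu> x $ 2) (at x)" if "x < 0" for x
      using dZ[OF that, of 1] unfolding G(1)[OF that] .
    have dZ2: "((\<lambda>x. Z \<mu> x $ 2) has_vector_derivative
        (of_real k + \<mu>) / of_real s * Z \<mu> x $ 2) (at x)" if "x < 0" for x
      using dZ[OF that, of 2] unfolding G(2)[OF that] .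
    note B = decaying_solution_bound[OF \<open>q > 0\<close> \<open>k > 0\<close> s(3) \<mu> hpos dh h0 h1 dZ1 lim dZ2 lim]
    have "Z \<mu> 0 $ 2 \<noteq> 0"
    proof
      assume "Z \<mu> 0 $ 2 = 0"
      then have "Z \<mu> x $ 1 = 0 \<and> Z \<mu> x $ 2 = 0" if "x < 0" for x
        using B(2) that by simp
      with m(3) show False by (auto simp: vector_2_eq_iff)
    qed
    with B(1) show ?thesis by (simp add: V_def)
  qed
  have lower: "norm (D_ZND s ub zb Z \<mu>) \<ge> norm \<mu> * norm (Z \<mu> 0 $ 2) * (2 * h1 - (h1 - h0 + q))"
    if "Re \<mu> \<ge> 0" for \<mu>
  proof -
    have "k * norm (V \<mu>) \<le> norm \<mu> * norm (Z \<mu> 0 $ 2) * (h1 - h0 + q)"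
      using main[OF that] \<open>k > 0\<close> by (simp add: field_simps)
    moreover have "norm (2 * of_real h1 * \<mu> * Z \<mu> 0 $ 2) = norm \<mu> * norm (Z \<mu> 0 $ 2) * (2 * h1)"
      using \<open>h1 > 0\<close> by (simp add: norm_mult)
    moreover have "norm (of_real k * V \<mu>) = k * norm (V \<mu>)"
      using \<open>k > 0\<close> by (simp add: norm_mult)
    ultimately show ?thesis
      using norm_triangle_ineq2[of "2 * of_real h1 * \<mu> * Z \<mu> 0 $ 2" "of_real k * V \<mu>"]
      unfolding D by (simp only: right_diff_distrib)
  qed
  \<comment> \<open>At \<open>\<mu> = 0\<close> the bound on \<open>V\<close> degenerates to 0, and
    the other term carries the factor \<open>\<mu>\<close>.\<close>
  have D0: "D_ZND s ub zb Z 0 = 0"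
    using main[of 0] by (simp add: D)
  have an: "D_ZND s ub zb Z analytic_on {0}"
  proof -
    have "(\<lambda>\<mu>. Z \<mu> 0 $ i) analytic_on {0}" for i
      using mode unfolding decaying_mode_def by (force intro: analytic_on_subset)
    then show ?thesis
      unfolding D V_def by (intro analytic_intros)
  qed
  then have "(D_ZND s ub zb Z has_field_derivative deriv (D_ZND s ub zb Z) 0) (at 0)"
    by (simp add: analytic_on_imp_differentiable_at DERIV_deriv_iff_field_differentiable)
  then have q: "((\<lambda>w. D_ZND s ub zb Z w / w) \<longlongrightarrow> deriv (D_ZND s ub zb Z) 0) (at 0)"
    by (simp add: DERIV_def D0)
  have cont: "((\<lambda>\<mu>. Z \<mu> 0 $ 2) \<longlongrightarrow> Z 0 0 $ 2) (at 0)"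
  proof -
    have "(\<lambda>\<mu>. Z \<mu> 0 $ 2) analytic_on {0}"
      using mode unfolding decaying_mode_def by (force intro: analytic_on_subset)
    then show ?thesis
      using analytic_at_imp_isCont isContD by blast
  qed
  \<comment> \<open>The positive real axis stays inside the half-plane on which \<open>lower\<close>
    holds, and analyticity at 0 makes the difference quotient along it converge to the full complex
    derivative.\<close>
  have r: "filterlim complex_of_real (at 0) (at_right 0)"
  proof -
    have "(complex_of_real \<longlongrightarrow> of_real 0) (at_right 0)" by (intro tendsto_intros)
    then show ?thesis by (auto simp: filterlim_at eventually_at_filter)
  qed
  have "norm (Z 0 0 $ 2) * (2 * h1 - (h1 - h0 + q)) \<le> norm (deriv (D_ZND s ub zb Z) 0)"
  proof (rule tendsto_le[OF trivial_limit_at_right_real])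
    show "((\<lambda>t. norm (D_ZND s ub zb Z (of_real t) / of_real t)) \<longlongrightarrow> norm (deriv (D_ZND s ub zb Z) 0)) (at_right 0)"
      by (intro tendsto_norm filterlim_compose[OF q r])
    show "((\<lambda>t. norm (Z (of_real t) 0 $ 2) * (2 * h1 - (h1 - h0 + q))) \<longlongrightarrow>
        norm (Z 0 0 $ 2) * (2 * h1 - (h1 - h0 + q))) (at_right 0)"
      by (intro tendsto_intros filterlim_compose[OF cont r])
    have "norm (Z (of_real t) 0 $ 2) * (2 * h1 - (h1 - h0 + q)) \<le> norm (D_ZND s ub zb Z (of_real t) / of_real t)"
      if "t > 0" for t
      using lower[of "of_real t"] that by (simp add: norm_divide pos_le_divide_eq mult_ac)
    then show "\<forall>\<^sub>F t in at_right 0. norm (Z (of_real t) 0 $ 2) * (2 * h1 - (h1 - h0 + q))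
        \<le> norm (D_ZND s ub zb Z (of_real t) / of_real t)"
      by (auto simp: eventually_at_filter)
  qed
  moreover have "norm (Z 0 0 $ 2) * (2 * h1 - (h1 - h0 + q)) > 0"
    using main[of 0] K by simp
  ultimately have "deriv (D_ZND s ub zb Z) 0 \<noteq> 0" by auto
  with an D0 have "zorder (D_ZND s ub zb Z) 0 = 1" by (intro zorder_eq_1I)
  moreover have "\<mu> = 0" if "Re \<mu> \<ge> 0" "D_ZND s ub zb Z \<mu> = 0" for \<mu>
  proof (rule ccontr)
    assume "\<mu> \<noteq> 0"
    then have "norm \<mu> * norm (Z \<mu> 0 $ 2) * (2 * h1 - (h1 - h0 + q)) > 0"
      using main[OF that(1)] K by simp
    with lower[OF that(1)] that(2) show False by simp
  qed
  ultimately show ?thesis using D0 by auto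
qed

theorem theorem5p1:
  fixes q k s up :: real
    and \<phi> ub zb :: "real \<Rightarrow> real"
    and Z :: "complex \<Rightarrow> real \<Rightarrow> complex^2"
  assumes "q > 0" and "k > 0" and "up \<ge> 0" and "s > up"
    and "2 * q * s < (s - up)\<^sup>2"
    and ignition:
      "(\<exists>ui. step_ignition ui \<phi> \<and> u_minus q s up > ui \<and> ui > up) \<or>
       ((\<exists>N. open N \<and> up \<in> N \<and> (\<forall>u\<in>N. \<phi> u = 0)) \<and>
        (\<exists>N. open N \<and> {u_minus q s up..u_star s up} \<subseteq> N \<and> (\<forall>u\<in>N. \<phi> u = 1)))"
    and wave: "strong_znd_detonation q k \<phi> s (u_minus q s up) up ub zb"
    and mode: "decaying_mode q k \<phi> s ub zb Z"
  shows "{\<mu>. Re \<mu> \<ge> 0 \<and> D_ZND s ub zb Z \<mu> = 0} = {0} \<and> zorder (D_ZND s ub zb Z) 0 = 1"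
proof -
  have "\<exists>N M. open N \<and> up \<in> N \<and> (\<forall>u\<in>N. \<phi> u = 0) \<and>
      open M \<and> {u_minus q s up..u_star s up} \<subseteq> M \<and> (\<forall>u\<in>M. \<phi> u = 1)"
    using ignition
  proof
    assume "\<exists>ui. step_ignition ui \<phi> \<and> u_minus q s up > ui \<and> ui > up"
    then obtain ui where "step_ignition ui \<phi>" "u_minus q s up > ui" "ui > up" by blast
    then show ?thesis
      \<comment> \<open>For a step the two open half-lines cut at \<open>ui\<close> serve as
        neighbourhoods; the whole interval from \<open>u_minus\<close> upwards lies above
        \<open>ui\<close>.\<close>
      by (intro exI[of _ "{..<ui}"] exI[of _ "{ui<..}"]) (auto simp: step_ignition_def)
  qed blast
  then obtain N M where "open N" "up \<in> N" "\<And>u. u \<in> N \<Longrightarrow> \<phi> u = 0"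
      "open M" "{u_minus q s up..u_star s up} \<subseteq> M" "\<And>u. u \<in> M \<Longrightarrow> \<phi> u = 1"
    by blast
  then show ?thesis
    by (rule D_ZND_zeros_of_locally_constant_ignition[OF assms(1,2,5) _ _ _ _ _ _ wave mode])
qed

end
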